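(* Let $\Omega\subset\mathbb{R}^3$ be an unbounded domain with $C^1$ boundary such that $\mathbb{R}^3\setminus\overline{\Omega}\neq\emptyset$, and let $\nu$ be the unit outer normal on $\partial\Omega$. Let $\mathbf{u}\in C^1(\Omega,\mathbb{R}^3)\cap C^0(\overline{\Omega},\mathbb{R}^3)$ satisfy $\operatorname{curl}\mathbf{u}\times\mathbf{u}=\mathbf{0}$ and $\operatorname{div}\mathbf{u}=0$ in $\Omega$, and $|\mathbf{u}(x)|=o(|x|^{-1})$ as $|x|\to+\infty$. Suppose in addition that either (i) $\Omega$ is star-shaped and $\mathbf{u}\times\nu=\mathbf{0}$ on $\partial\Omega$, or (ii) $\Omega=\mathbb{R}^3\setminus\overline{D}$ for some star-shaped domain $D\subset\mathbb{R}^3$ (bounded or unbounded), and $\mathbf{u}\cdot\nu=0$ on $\partial\Omega$. Then $\mathbf{u}\equiv\mathbf{0}$ in $\Omega$.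
   Context: A domain $D\subset\mathbb{R}^3$ is called star-shaped if there exists a point $x_0\in D$ such that for every $x\in\overline{D}$ the segment $\{tx_0+(1-t)x: t\in[0,1]\}$ lies in $\overline{D}$. *)

theory Defs
  imports "HOL-Analysis.Analysis"
begin

definition domain3 :: "(real^3) set \<Rightarrow> bool" where
  "domain3 S \<longleftrightarrow> open S \<and> connected S \<and> S \<noteq> {}"

definition star_shaped_domain :: "(real^3) set \<Rightarrow> bool" where
  "star_shaped_domain D \<longleftrightarrow> domain3 D \<and>
     (\<exists>x0\<in>D. \<forall>x\<in>closure D. closed_segment x0 x \<subseteq> closure D)"

definition local_defining_function ::
  "(real^3) set \<Rightarrow> real^3 \<Rightarrow> real \<Rightarrow> (real^3 \<Rightarrow> real) \<Rightarrow> (real^3 \<Rightarrow> real^3) \<Rightarrow> bool" where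
  "local_defining_function \<Omega> p r \<phi> G \<longleftrightarrow> r > 0 \<and>
     continuous_on (ball p r) G \<and>
     (\<forall>x\<in>ball p r. (\<phi> has_derivative (\<lambda>h. G x \<bullet> h)) (at x) \<and> G x \<noteq> 0) \<and>
     \<Omega> \<inter> ball p r = {x\<in>ball p r. \<phi> x < 0} \<and>
     frontier \<Omega> \<inter> ball p r = {x\<in>ball p r. \<phi> x = 0}"

definition C1_boundary :: "(real^3) set \<Rightarrow> bool" where
  "C1_boundary \<Omega> \<longleftrightarrow> (\<forall>p\<in>frontier \<Omega>. \<exists>r \<phi> G. local_defining_function \<Omega> p r \<phi> G)"

definition outer_normal :: "(real^3) set \<Rightarrow> real^3 \<Rightarrow> real^3 \<Rightarrow> bool" where
  "outer_normal \<Omega> p n \<longleftrightarrow> (\<exists>r \<phi> G. local_defining_function \<Omega> p r \<phi> G \<and>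
       n = (1 / norm (G p)) *\<^sub>R G p)"

definition C1_on :: "(real^3) set \<Rightarrow> (real^3 \<Rightarrow> real^3) \<Rightarrow> bool" where
  "C1_on S u \<longleftrightarrow> (\<exists>J :: real^3 \<Rightarrow> real^3^3. continuous_on S J \<and>
      (\<forall>x\<in>S. (u has_derivative (\<lambda>h. J x *v h)) (at x)))"

definition pderiv3 :: "(real^3 \<Rightarrow> real^3) \<Rightarrow> 3 \<Rightarrow> 3 \<Rightarrow> real^3 \<Rightarrow> real" where
  "pderiv3 u i j x = deriv (\<lambda>t. u (x + t *\<^sub>R axis j 1) $ i) 0"

definition div3 :: "(real^3 \<Rightarrow> real^3) \<Rightarrow> real^3 \<Rightarrow> real" where
  "div3 u x = pderiv3 u 1 1 x + pderiv3 u 2 2 x + pderiv3 u 3 3 x"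

definition curl3 :: "(real^3 \<Rightarrow> real^3) \<Rightarrow> real^3 \<Rightarrow> real^3" where
  "curl3 u x = vector [pderiv3 u 3 2 x - pderiv3 u 2 3 x,
                       pderiv3 u 1 3 x - pderiv3 u 3 1 x,
                       pderiv3 u 2 1 x - pderiv3 u 1 2 x]"

end

theory Submission
  imports Defs
begin

text \<open>
  Let \<open>X = x - x0\<close>, where \<open>x0\<close> is the star centre. The two equations say that the stress tensor
  \<open>T = u \<otimes> u - |u|\<^sup>2/2 I\<close> is divergence free, so \<open>div (T X) = tr T = - |u|\<^sup>2/2\<close>; under either
  boundary condition, star-shapedness gives \<open>T X \<bullet> \<nu> \<ge> 0\<close>. For a multiplier \<open>e(q)\<close>,
  \<open>q = |X|\<^sup>2\<close>, decreasing and of bounded support, \<open>\<integral> div (e T X) \<ge> 0\<close> then yields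
  \<open>\<integral> (e + 2 q e') |u|\<^sup>2 \<le> 0\<close>. The choice \<open>e = (1 + q) powr (-1/2)\<close> makes the weight
  \<open>e + 2 q e' = (1 + q) powr (-3/2)\<close> positive, and cutting it off between radii \<open>L\<close> and \<open>2 L\<close> costs
  an error of order \<open>sup (|X| |u|)\<^sup>2\<close> over \<open>|X| \<ge> L\<close>, which tends to \<open>0\<close> by the decay assumption.

  No surface measure is needed: only the sign of the flux enters, and near the boundary one replaces
  the indicator of the domain by a smooth function of \<open>- \<phi>/\<epsilon>\<close>, whose gradient points
  in the direction of \<open>- G\<close>, the inner normal.
\<close>

section \<open>A continuously differentiable cutoff on the real line\<close>

lemma DERIV_max_0_square:
  "((\<lambda>t::real. (max 0 t)\<^sup>2) has_real_derivative 2 * max 0 t) (at t)"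
proof (cases "t = 0")
  case True
  have "((\<lambda>h::real. ((max 0 h)\<^sup>2) / h) \<longlongrightarrow> 0) (at 0)"
  proof (rule Lim_null_comparison)
    show "\<forall>\<^sub>F h in at 0. norm ((max 0 h)\<^sup>2 / h) \<le> \<bar>h::real\<bar>"
      by (intro always_eventually allI) (auto simp: max_def power2_eq_square)
    show "((\<lambda>h::real. \<bar>h\<bar>) \<longlongrightarrow> 0) (at 0)"
      by (intro tendsto_eq_intros) auto
  qed
  then show ?thesis
    using True by (simp add: DERIV_def)
next
  case False
  show ?thesis
  proof (cases "t > 0")
    case True
    have "((\<lambda>t::real. t\<^sup>2) has_real_derivative 2 * max 0 t) (at t)"
      using True by (auto intro!: derivative_eq_intros)
    then show ?thesis
      by (rule has_field_derivative_transform_within_open[of _ _ _ "{0<..}"]) (use True in auto)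
  next
    case neg: False
    have "((\<lambda>t::real. 0) has_real_derivative 2 * max 0 t) (at t)"
      using neg by (auto intro!: derivative_eq_intros)
    then show ?thesis
      by (rule has_field_derivative_transform_within_open[of _ _ _ "{..<0}"]) (use neg False in auto)
  qed
qed

text \<open>The squared positive part is C1, and nesting it twice gives a C1 descent from 1 at t
  \<le> 0 to 0 at t \<ge> 1. Only first derivatives are integrated below, so a piecewise polynomial
  suffices.\<close>

definition cutoff :: "real \<Rightarrow> real" where
  "cutoff t = (max 0 (1 - (max 0 t)\<^sup>2))\<^sup>2"

definition cutoff' :: "real \<Rightarrow> real" where
  "cutoff' t = - 4 * (max 0 t * max 0 (1 - (max 0 t)\<^sup>2))"

lemma DERIV_cutoff: "(cutoff has_real_derivative cutoff' t) (at t)"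
proof -
  have "((\<lambda>t::real. 1 - (max 0 t)\<^sup>2) has_real_derivative - (2 * max 0 t)) (at t)"
    by (rule DERIV_cong[OF DERIV_diff[OF DERIV_const DERIV_max_0_square]]) simp
  from DERIV_chain2[OF DERIV_max_0_square this]
  show ?thesis
    unfolding cutoff_def[abs_def] cutoff'_def by (simp add: mult_ac)
qed

lemma continuous_on_cutoff' [continuous_intros]:
  "continuous_on S f \<Longrightarrow> continuous_on S (\<lambda>x. cutoff' (f x))"
  unfolding cutoff'_def by (intro continuous_intros)

lemma continuous_on_cutoff [continuous_intros]:
  "continuous_on S f \<Longrightarrow> continuous_on S (\<lambda>x. cutoff (f x))"
  unfolding cutoff_def by (intro continuous_intros)

lemma cutoff_nonneg: "0 \<le> cutoff t"
  by (simp add: cutoff_def)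

lemma cutoff_le_1: "cutoff t \<le> 1"
  unfolding cutoff_def by (intro power_le_one) auto

lemma cutoff_eq_1: "t \<le> 0 \<Longrightarrow> cutoff t = 1"
  by (simp add: cutoff_def max_def)

lemma cutoff_eq_0: "1 \<le> t \<Longrightarrow> cutoff t = 0"
  by (simp add: cutoff_def max_def power2_eq_square) (metis mult_mono' mult_1 zero_le_one order.trans antisym)

lemma cutoff'_nonpos: "cutoff' t \<le> 0"
  by (simp add: cutoff'_def)

lemma cutoff'_eq_0_left: "t \<le> 0 \<Longrightarrow> cutoff' t = 0"
  by (simp add: cutoff'_def)

lemma cutoff'_eq_0_right: "1 \<le> t \<Longrightarrow> cutoff' t = 0"
  by (simp add: cutoff'_def max_def power2_eq_square) (metis mult_mono' mult_1 zero_le_one order.trans antisym)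

lemma cutoff'_ge: "- 4 \<le> cutoff' t"
proof (cases "t \<ge> 1")
  case False
  then have "max 0 t * max 0 (1 - (max 0 t)\<^sup>2) \<le> 1 * 1"
    by (intro mult_mono) auto
  then show ?thesis by (simp add: cutoff'_def)
qed (simp add: cutoff'_eq_0_right)

section \<open>C1 maps carried together with their derivatives, and the divergence\<close>

definition C1_deriv_on :: "'a::euclidean_space set \<Rightarrow> ('a \<Rightarrow> 'b::real_normed_vector) \<Rightarrow> ('a \<Rightarrow> 'a \<Rightarrow> 'b) \<Rightarrow> bool" where
  "C1_deriv_on S f f' \<longleftrightarrow>
     (\<forall>x\<in>S. (f has_derivative f' x) (at x)) \<and> (\<forall>h. continuous_on S (\<lambda>x. f' x h))"

text \<open>The trace is taken of a given derivative \<open>F'\<close> instead of \<open>F\<close>,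
  so sum and product rules become rewriting of \<open>F'\<close>. In finite dimension, continuity
  for each fixed direction as in \<open>C1_deriv_on\<close> amounts to continuity in operator
  norm.\<close>

definition dvg :: "('a::euclidean_space \<Rightarrow> 'a \<Rightarrow> 'a) \<Rightarrow> 'a \<Rightarrow> real" where
  "dvg F' x = (\<Sum>b\<in>Basis. F' x b \<bullet> b)"

lemma C1_deriv_onD:
  assumes "C1_deriv_on S f f'"
  shows "x \<in> S \<Longrightarrow> (f has_derivative f' x) (at x)"
    and "continuous_on S (\<lambda>x. f' x h)" and "continuous_on S f"
  using assms by (auto simp: C1_deriv_on_def
      intro!: continuous_at_imp_continuous_on has_derivative_continuous)

lemma C1_deriv_on_subset:
  "C1_deriv_on S f f' \<Longrightarrow> T \<subseteq> S \<Longrightarrow> C1_deriv_on T f f'"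
  unfolding C1_deriv_on_def by (meson continuous_on_subset subsetD)

lemma C1_deriv_on_add:
  assumes "C1_deriv_on S f f'" "C1_deriv_on S g g'"
  shows "C1_deriv_on S (\<lambda>x. f x + g x) (\<lambda>x h. f' x h + g' x h)"
  using assms unfolding C1_deriv_on_def
  by (auto intro!: continuous_intros derivative_eq_intros)

lemma C1_deriv_on_const: "C1_deriv_on S (\<lambda>x. c) (\<lambda>x h. 0)"
  unfolding C1_deriv_on_def by auto

lemma C1_deriv_on_scaleR:
  assumes "C1_deriv_on S f f'" "C1_deriv_on S g g'"
  shows "C1_deriv_on S (\<lambda>x. f x *\<^sub>R g x) (\<lambda>x h. f x *\<^sub>R g' x h + f' x h *\<^sub>R g x)"
  using assms C1_deriv_onD(3)[OF assms(1)] C1_deriv_onD(3)[OF assms(2)]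
  unfolding C1_deriv_on_def
  by (auto intro!: continuous_intros derivative_eq_intros)

lemma C1_deriv_on_inner:
  assumes "C1_deriv_on S f f'" "C1_deriv_on S g g'"
  shows "C1_deriv_on S (\<lambda>x. f x \<bullet> g x) (\<lambda>x h. f x \<bullet> g' x h + f' x h \<bullet> g x)"
  using assms C1_deriv_onD(3)[OF assms(1)] C1_deriv_onD(3)[OF assms(2)]
  unfolding C1_deriv_on_def
  by (auto intro!: continuous_intros derivative_eq_intros)

text \<open>\<open>g\<close> is differentiated only at values of \<open>f\<close>: the radial
  multiplier used later contains a square root and is differentiated at t \<ge> 0 only.\<close>

lemma C1_deriv_on_compose:
  assumes "C1_deriv_on S f f'" "\<And>x. x \<in> S \<Longrightarrow> (g has_real_derivative g' (f x)) (at (f x))"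
    and "continuous_on S (\<lambda>x. g' (f x))"
  shows "C1_deriv_on S (\<lambda>x. g (f x)) (\<lambda>x h. g' (f x) * f' x h)"
proof -
  have "((\<lambda>x. g (f x)) has_derivative (\<lambda>h. g' (f x) * f' x h)) (at x)" if "x \<in> S" for x
    using has_derivative_compose[OF C1_deriv_onD(1)[OF assms(1) that]
        assms(2)[unfolded has_field_derivative_def, OF that]] by simp
  then show ?thesis
    using assms(1,3) unfolding C1_deriv_on_def by (auto intro!: continuous_intros)
qed

lemma continuous_on_dvg: "C1_deriv_on S F F' \<Longrightarrow> continuous_on S (dvg F')"
  unfolding dvg_def[abs_def] C1_deriv_on_def by (intro continuous_intros) auto

lemma C1_deriv_on_eq_0:
  assumes "C1_deriv_on S F F'" "open T" "x \<in> S" "x \<in> T" "\<And>y. y \<in> T \<Longrightarrow> F y = 0"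
  shows "F' x h = 0"
proof -
  have "(F has_derivative (\<lambda>h. 0)) (at x)"
    using assms(2,4,5) has_derivative_transform_within_open[of "\<lambda>_. 0" "\<lambda>_. 0" x UNIV T F] by auto
  then show ?thesis
    using has_derivative_unique C1_deriv_onD(1)[OF assms(1,3)] by metis
qed

section \<open>Integrals over open sets and divergences of compactly supported fields\<close>

lemma continuous_bounded_support:
  fixes f :: "'a::euclidean_space \<Rightarrow> real"
  assumes "closed S" "continuous_on S f" "\<And>x. x \<in> S \<Longrightarrow> x \<notin> cball p R \<Longrightarrow> f x = 0"
  obtains C where "\<And>x. x \<in> S \<Longrightarrow> \<bar>f x\<bar> \<le> C"
proof -
  have "compact (f ` (S \<inter> cball p R))"
    using assms(1) by (intro compact_continuous_image continuous_on_subset[OF assms(2)]) (auto intro: closed_Int_compact)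
  then obtain B where B: "\<And>x. x \<in> S \<inter> cball p R \<Longrightarrow> \<bar>f x\<bar> \<le> B"
    by (fastforce dest!: compact_imp_bounded simp: bounded_iff)
  have "\<bar>f x\<bar> \<le> max B 0" if "x \<in> S" for x
    using B[of x] assms(3)[OF that] that by (cases "x \<in> cball p R") auto
  then show thesis using that by blast
qed

text \<open>\<open>f\<close> may have no continuous extension to the boundary of \<open>S\<close>,
  so a bounded support does not bound its values; the bound \<open>C\<close> is separate
  data.\<close>

lemma set_integrable_bounded_continuous:
  fixes f :: "'a::euclidean_space \<Rightarrow> real"
  assumes "open S" "continuous_on S f" "\<And>x. x \<in> S \<Longrightarrow> \<bar>f x\<bar> \<le> C"
    and "\<And>x. x \<in> S \<Longrightarrow> x \<notin> cball p R \<Longrightarrow> f x = 0"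
  shows "set_integrable lborel S f"
  unfolding set_integrable_def
proof (rule Bochner_Integration.integrable_bound)
  show "integrable lborel (\<lambda>x. indicator (cball p R) x *\<^sub>R C)"
    by (intro borel_integrable_compact continuous_intros) auto
  show "(\<lambda>x. indicat_real S x *\<^sub>R f x) \<in> borel_measurable lborel"
    using assms(1,2) borel_measurable_continuous_on_indicator[of S f] by simp
  show "AE x in lborel. norm (indicat_real S x *\<^sub>R f x) \<le> norm (indicat_real (cball p R) x *\<^sub>R C)"
    using assms(3,4) by (intro always_eventually allI) (force simp: indicator_def)
qed

text \<open>Lebesgue measure is translation invariant, so all difference quotients have integral 0.\<close>
lemma integral_directional_derivative_eq_0:
  fixes g :: "'a::euclidean_space \<Rightarrow> real"
  assumes g: "C1_deriv_on UNIV g g'" and supp: "\<And>x. x \<notin> cball 0 R \<Longrightarrow> g x = 0"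
  shows "integral\<^sup>L lborel (\<lambda>x. g' x h) = 0"
proof -
  note D = C1_deriv_onD[OF g]
  have contg: "continuous_on UNIV g" by (rule D(3))
  have int_g: "integrable lborel g"
  proof -
    have "integrable lborel (\<lambda>x. indicator (cball 0 R) x *\<^sub>R g x)"
      by (intro borel_integrable_compact continuous_on_subset[OF contg]) auto
    also have "(\<lambda>x. indicator (cball 0 R) x *\<^sub>R g x) = g"
      using supp by (force simp: indicator_def)
    finally show ?thesis .
  qed
  have g'0: "g' x h = 0" if "x \<notin> cball 0 R" for x
    by (rule C1_deriv_on_eq_0[OF g, of "- cball 0 R"]) (use that supp in auto)
  obtain C where C: "\<And>x. \<bar>g' x h\<bar> \<le> C"
    by (rule continuous_bounded_support[OF closed_UNIV D(2)[of h], of 0 R]) (use g'0 in auto)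
  define d where "d n x = real (Suc n) * (g (x + (1 / real (Suc n)) *\<^sub>R h) - g x)" for n x
  have int_shift: "integrable lborel (\<lambda>x. g (x + c))" "integral\<^sup>L lborel (\<lambda>x. g (x + c)) = integral\<^sup>L lborel g" for c
  proof -
    have eq: "distr lborel borel (\<lambda>x. x + c) = lborel"
      using lborel_distr_plus[of c] by (subst add.commute)
    have gm: "g \<in> borel_measurable borel"
      using contg by (rule borel_measurable_continuous_onI)
    show "integrable lborel (\<lambda>x. g (x + c))"
      using int_g gm by (subst (asm) eq[symmetric]) (simp add: integrable_distr_eq)
    show "integral\<^sup>L lborel (\<lambda>x. g (x + c)) = integral\<^sup>L lborel g"
      using gm by (subst (2) eq[symmetric]) (simp add: integral_distr)
  qed
  have "(\<lambda>n. integral\<^sup>L lborel (d n)) \<longlonglongrightarrow> integral\<^sup>L lborel (\<lambda>x. g' x h)"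
  proof (rule integral_dominated_convergence)
    show "(\<lambda>x. g' x h) \<in> borel_measurable lborel"
      using D(2)[of h] borel_measurable_continuous_onI by auto
    show "d n \<in> borel_measurable lborel" for n
      unfolding d_def[abs_def] using contg
      by (simp, intro borel_measurable_continuous_onI continuous_intros continuous_on_compose2[OF contg]) auto
    \<comment> \<open>The steps have length at most \<open>norm h\<close>, so outside this ball both
      points of the quotient miss the support; inside it the mean value theorem bounds the quotient
      by \<open>C\<close>.\<close>
    show "integrable lborel (\<lambda>x. indicator (cball 0 (R + norm h)) x *\<^sub>R C)"
      by (intro borel_integrable_compact continuous_intros) auto
    show "AE x in lborel. (\<lambda>n. d n x) \<longlonglongrightarrow> g' x h"
    proof (intro always_eventually allI)
      fix x
      have 1: "((\<lambda>t. g (x + t *\<^sub>R h)) has_real_derivative g' x h) (at 0)"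
      proof -
        have "((\<lambda>t::real. x + t *\<^sub>R h) has_derivative (\<lambda>t. t *\<^sub>R h)) (at 0)"
          by (auto intro!: derivative_eq_intros)
        from has_derivative_compose[OF this, of g "g' x"] D(1)[of x]
        have "((\<lambda>t. g (x + t *\<^sub>R h)) has_derivative (\<lambda>t. g' x (t *\<^sub>R h))) (at 0)" by simp
        moreover have "g' x (t *\<^sub>R h) = g' x h * t" for t
          using linear_scale[OF has_derivative_linear[OF D(1)[of x]], of t h] by simp
        ultimately show ?thesis by (simp add: has_field_derivative_def)
      qed
      have "filterlim (\<lambda>n. 1 / real (Suc n)) (at 0) sequentially"
        using LIMSEQ_inverse_real_of_nat
        by (auto simp: filterlim_at inverse_eq_divide simp del: of_nat_Suc)
      from filterlim_compose[OF 1[unfolded DERIV_def] this]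
      have "(\<lambda>n. (g (x + (0 + 1 / real (Suc n)) *\<^sub>R h) - g (x + 0 *\<^sub>R h)) / (1 / real (Suc n))) \<longlonglongrightarrow> g' x h" .
      then show "(\<lambda>n. d n x) \<longlonglongrightarrow> g' x h"
        by (simp add: d_def mult.commute)
    qed
    show "AE x in lborel. norm (d n x) \<le> indicator (cball 0 (R + norm h)) x *\<^sub>R C" for n
    proof (intro always_eventually allI)
      fix x
      define \<tau> where "\<tau> = 1 / real (Suc n)"
      have \<tau>: "0 < \<tau>" "\<tau> \<le> 1" by (auto simp: \<tau>_def)
      show "norm (d n x) \<le> indicator (cball 0 (R + norm h)) x *\<^sub>R C"
      proof (cases "x \<in> cball 0 (R + norm h)")
        case False
        have "norm x \<le> norm (x + \<tau> *\<^sub>R h) + \<tau> * norm h"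
          using norm_triangle_ineq4[of "x + \<tau> *\<^sub>R h" "\<tau> *\<^sub>R h"] \<tau> by simp
        moreover have "\<tau> * norm h \<le> norm h"
          using \<tau> by (simp add: mult_left_le_one_le)
        ultimately have "g (x + \<tau> *\<^sub>R h) = 0" "g x = 0"
          using False norm_ge_zero[of h] by (auto intro!: supp simp del: norm_ge_zero)
        then show ?thesis
          using False by (simp add: d_def \<tau>_def)
      next
        case True
        have dv: "((\<lambda>t. g (x + t *\<^sub>R h)) has_real_derivative g' (x + t *\<^sub>R h) h) (at t)" for t
        proof -
          have "((\<lambda>t::real. x + t *\<^sub>R h) has_derivative (\<lambda>t. t *\<^sub>R h)) (at t)"
            by (auto intro!: derivative_eq_intros)
          from has_derivative_compose[OF this D(1)[of "x + t *\<^sub>R h"]]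
          have "((\<lambda>t. g (x + t *\<^sub>R h)) has_derivative (\<lambda>s. g' (x + t *\<^sub>R h) (s *\<^sub>R h))) (at t)" by simp
          moreover have "g' (x + t *\<^sub>R h) (s *\<^sub>R h) = g' (x + t *\<^sub>R h) h * s" for s
            using linear_scale[OF has_derivative_linear[OF D(1)[of "x + t *\<^sub>R h"]], of s h] by simp
          ultimately show ?thesis by (simp add: has_field_derivative_def)
        qed
        obtain z where "g (x + \<tau> *\<^sub>R h) - g (x + 0 *\<^sub>R h) = (\<tau> - 0) * g' (x + z *\<^sub>R h) h"
          using MVT2[OF \<tau>(1) dv] by blast
        then have "d n x = g' (x + z *\<^sub>R h) h"
          using \<tau>(1) by (simp add: d_def \<tau>_def divide_simps mult.commute del: of_nat_Suc)
        then show ?thesis using True C by simp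
      qed
    qed
  qed
  moreover have "integral\<^sup>L lborel (d n) = 0" for n
    unfolding d_def[abs_def]
    using int_shift int_g by (simp del: of_nat_Suc)
  ultimately show ?thesis
    by (simp add: LIMSEQ_const_iff)
qed

text \<open>\<open>S\<close> and the complement of \<open>K\<close> form an open cover of the space,
  so extension by zero is C1 everywhere. The divergence is then a sum of directional derivatives of
  compactly supported functions, each of integral 0.\<close>

lemma integral_dvg_compact_support:
  assumes "open S" and F: "C1_deriv_on S F F'" and "compact K" "K \<subseteq> S"
    and supp: "\<And>x. x \<in> S \<Longrightarrow> x \<notin> K \<Longrightarrow> F x = 0"
  shows "set_integrable lborel S (dvg F')"
    and "set_lebesgue_integral lborel S (dvg F') = 0"
proof -
  define F0 where "F0 x = (if x \<in> S then F x else 0)" for x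
  define F0' where "F0' x h = (if x \<in> S then F' x h else 0)" for x h
  have oK: "open (- K)" using assms(3) by (simp add: compact_imp_closed open_Compl)
  have F0K: "F0 x = 0" if "x \<notin> K" for x
    using supp that by (simp add: F0_def)
  have F'K: "F' x h = 0" if "x \<in> S" "x \<notin> K" for x h
    by (rule C1_deriv_on_eq_0[OF F, of "S \<inter> - K"]) (use that supp oK assms(1) in auto)
  have C1: "C1_deriv_on UNIV F0 F0'"
    unfolding C1_deriv_on_def
  proof safe
    fix x
    show "(F0 has_derivative F0' x) (at x)"
    proof (cases "x \<in> S")
      case True
      then have "(F has_derivative F0' x) (at x)"
        using C1_deriv_onD(1)[OF F True] True by (simp add: F0'_def[abs_def])
      then show ?thesis
        by (rule has_derivative_transform_within_open[OF _ assms(1) True]) (simp add: F0_def)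
    next
      case False
      then have "((\<lambda>_. 0) has_derivative F0' x) (at x)" by (simp add: F0'_def[abs_def])
      then show ?thesis
        by (rule has_derivative_transform_within_open[OF _ oK]) (use False assms(4) F0K in auto)
    qed
  next
    fix h
    have "continuous_on S (\<lambda>x. F0' x h)"
      using C1_deriv_onD(2)[OF F, of h] by (simp add: F0'_def)
    moreover have "continuous_on (- K) (\<lambda>x. F0' x h)"
      using F'K by (intro continuous_on_eq[OF continuous_on_const[of _ 0]]) (auto simp: F0'_def)
    ultimately have "continuous_on (S \<union> - K) (\<lambda>x. F0' x h)"
      using assms(1) oK by (intro continuous_on_open_Un)
    moreover have "S \<union> - K = UNIV" using assms(4) by auto
    ultimately show "continuous_on UNIV (\<lambda>x. F0' x h)" by simp
  qed
  obtain R where R: "K \<subseteq> cball 0 R"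
    using bounded_subset_ballD[OF compact_imp_bounded[OF assms(3)], of 0] ball_subset_cball by blast
  have eq: "(\<lambda>x. indicator S x *\<^sub>R dvg F' x) = dvg F0'"
    by (auto simp: fun_eq_iff dvg_def F0'_def indicator_def)
  have comp: "C1_deriv_on UNIV (\<lambda>x. F0 x \<bullet> b) (\<lambda>x h. F0' x h \<bullet> b)" for b
    using C1_deriv_on_inner[OF C1 C1_deriv_on_const[of UNIV b]] by simp
  have comp_int: "integrable lborel (\<lambda>x. F0' x b \<bullet> b)" for b
  proof -
    have "integrable lborel (\<lambda>x. indicator K x *\<^sub>R (F0' x b \<bullet> b))"
      by (intro borel_integrable_compact assms(3) continuous_on_subset[OF C1_deriv_onD(2)[OF comp]]) auto
    also have "(\<lambda>x. indicator K x *\<^sub>R (F0' x b \<bullet> b)) = (\<lambda>x. F0' x b \<bullet> b)"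
      using F'K by (auto simp: fun_eq_iff indicator_def F0'_def)
    finally show ?thesis .
  qed
  have comp_0: "integral\<^sup>L lborel (\<lambda>x. F0' x b \<bullet> b) = 0" for b
  proof (rule integral_directional_derivative_eq_0[OF comp])
    fix x :: 'a assume "x \<notin> cball 0 R"
    then have "F0 x = 0" using R F0K by blast
    then show "F0 x \<bullet> b = 0" by simp
  qed
  show "set_integrable lborel S (dvg F')"
    unfolding set_integrable_def eq unfolding dvg_def
    by (intro Bochner_Integration.integrable_sum comp_int)
  show "set_lebesgue_integral lborel S (dvg F') = 0"
    unfolding set_lebesgue_integral_def eq unfolding dvg_def
    by (subst Bochner_Integration.integral_sum) (use comp_int comp_0 in auto)
qed

section \<open>Localisation by bump functions and a divergence inequality for outward fields\<close>

lemma dvg_scaleR: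
  "dvg (\<lambda>x h. f x *\<^sub>R g' x h + f' x h *\<^sub>R g x) x =
     f x * dvg g' x + (\<Sum>b\<in>Basis. f' x b * (g x \<bullet> b))"
  by (simp add: dvg_def inner_add_left sum.distrib sum_distrib_left)

lemma dvg_add: "dvg (\<lambda>x h. f' x h + g' x h) x = dvg f' x + dvg g' x"
  by (simp add: dvg_def inner_add_left sum.distrib)

text \<open>Applying the cutoff to the squared distance keeps the function differentiable at the
  centre. It vanishes already from radius \<open>sqrt 2 * \<rho>\<close> on;
  \<open>2 * \<rho>\<close> is a convenient coarser radius.\<close>

lemma bump_function:
  fixes p :: "'a::euclidean_space"
  assumes "\<rho> > 0"
  obtains b b' where "C1_deriv_on UNIV b b'" "\<And>x. 0 \<le> b x" "\<And>x. b x \<le> (1::real)"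
    "\<And>x. x \<in> cball p \<rho> \<Longrightarrow> b x = 1" "\<And>x. x \<notin> ball p (2*\<rho>) \<Longrightarrow> b x = 0"
proof -
  define k where "k = 1 / \<rho>\<^sup>2"
  define q where "q x = k * ((x - p) \<bullet> (x - p)) - 1" for x
  define q' where "q' x h = k * (2 * ((x - p) \<bullet> h))" for x h
  have "C1_deriv_on UNIV q q'"
    unfolding C1_deriv_on_def q_def q'_def
    by (auto intro!: derivative_eq_intros continuous_intros simp: inner_commute)
  from C1_deriv_on_compose[OF this DERIV_cutoff continuous_on_cutoff'[OF C1_deriv_onD(3)[OF this]]]
  have "C1_deriv_on UNIV (\<lambda>x. cutoff (q x)) (\<lambda>x h. cutoff' (q x) * q' x h)" .
  moreover have "cutoff (q x) = 1" if "x \<in> cball p \<rho>" for x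
  proof (rule cutoff_eq_1)
    have "(norm (x - p))\<^sup>2 \<le> \<rho>\<^sup>2"
      using that by (intro power_mono) (auto simp: dist_norm norm_minus_commute)
    then show "q x \<le> 0" using assms by (simp add: q_def k_def power2_norm_eq_inner)
  qed
  moreover have "cutoff (q x) = 0" if "x \<notin> ball p (2*\<rho>)" for x
  proof (rule cutoff_eq_0)
    have "(2*\<rho>)\<^sup>2 \<le> (norm (x - p))\<^sup>2"
      using that assms by (intro power_mono) (auto simp: dist_norm norm_minus_commute)
    then have "4 * \<rho>\<^sup>2 \<le> (x - p) \<bullet> (x - p)" by (simp add: power2_norm_eq_inner power_mult_distrib)
    then have "4 \<le> (x - p) \<bullet> (x - p) / \<rho>\<^sup>2" using assms by (simp add: pos_le_divide_eq)
    then show "1 \<le> q x" by (simp add: q_def k_def)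
  qed
  ultimately show thesis
    by (intro that[of "\<lambda>x. cutoff (q x)"]) (auto simp: cutoff_nonneg cutoff_le_1)
qed

text \<open>Only the divergence has to be bounded: the derivative of a field that is merely
  continuous up to the boundary may blow up there. The flux is tested against \<open>G p\<close>, a
  positive multiple of the outer normal.\<close>

definition outward_field :: "(real^3) set \<Rightarrow> (real^3 \<Rightarrow> real^3) \<Rightarrow> (real^3 \<Rightarrow> real^3 \<Rightarrow> real^3) \<Rightarrow> bool" where
  "outward_field \<Omega> F F' \<longleftrightarrow> continuous_on (closure \<Omega>) F \<and> C1_deriv_on \<Omega> F F' \<and>
     (\<exists>C. \<forall>x\<in>\<Omega>. \<bar>dvg F' x\<bar> \<le> C) \<and> (\<exists>R. \<forall>x\<in>closure \<Omega>. x \<notin> cball 0 R \<longrightarrow> F x = 0) \<and>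
     (\<forall>p\<in>frontier \<Omega>. \<forall>r \<phi> G. local_defining_function \<Omega> p r \<phi> G \<longrightarrow> 0 \<le> F p \<bullet> G p)"

lemma set_integrable_dvg:
  assumes "open \<Omega>" "outward_field \<Omega> F F'"
  shows "set_integrable lborel \<Omega> (dvg F')"
proof -
  from assms(2) obtain C R where C1: "C1_deriv_on \<Omega> F F'" and C: "\<And>x. x \<in> \<Omega> \<Longrightarrow> \<bar>dvg F' x\<bar> \<le> C"
    and R: "\<And>x. x \<in> closure \<Omega> \<Longrightarrow> x \<notin> cball 0 R \<Longrightarrow> F x = 0"
    unfolding outward_field_def by blast
  show ?thesis
  proof (rule set_integrable_bounded_continuous[where p = 0 and R = R, OF assms(1) continuous_on_dvg[OF C1] C])
    fix x assume x: "x \<in> \<Omega>" "x \<notin> cball 0 R"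
    have "F' x h = 0" for h
      by (rule C1_deriv_on_eq_0[OF C1, of "\<Omega> \<inter> - cball 0 R"])
        (use x R assms(1) closure_subset[of \<Omega>] in auto)
    then show "dvg F' x = 0" by (simp add: dvg_def)
  qed auto
qed

text \<open>The product rule adds only \<open>F\<close> paired with the gradient of
  \<open>b\<close>, which is continuous on a compact part of the closure. Hence the divergence stays
  bounded even if \<open>F'\<close> does not, and outward fields can be split by bump
  functions.\<close>

lemma outward_field_scaleR:
  assumes "open \<Omega>" and F: "outward_field \<Omega> F F'" and b: "C1_deriv_on UNIV b b'" "\<And>x. 0 \<le> b x"
  shows "outward_field \<Omega> (\<lambda>x. b x *\<^sub>R F x) (\<lambda>x h. b x *\<^sub>R F' x h + b' x h *\<^sub>R F x)"
proof -
  from F obtain C R where cont: "continuous_on (closure \<Omega>) F" and C1: "C1_deriv_on \<Omega> F F'"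
    and C: "\<And>x. x \<in> \<Omega> \<Longrightarrow> \<bar>dvg F' x\<bar> \<le> C"
    and R: "\<And>x. x \<in> closure \<Omega> \<Longrightarrow> x \<notin> cball 0 R \<Longrightarrow> F x = 0"
    and nn: "\<forall>p\<in>frontier \<Omega>. \<forall>r \<phi> G. local_defining_function \<Omega> p r \<phi> G \<longrightarrow> 0 \<le> F p \<bullet> G p"
    unfolding outward_field_def by blast
  note bD = C1_deriv_onD[OF b(1)]
  let ?K = "closure \<Omega> \<inter> cball 0 R"
  let ?B = "\<lambda>x. \<Sum>e\<in>Basis. b' x e * (F x \<bullet> e)"
  have clK: "closed ?K" by auto
  obtain B1 where B1: "\<And>x. x \<in> ?K \<Longrightarrow> \<bar>?B x\<bar> \<le> B1"
    by (rule continuous_bounded_support[OF clK, of ?B 0 R])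
       (auto intro!: continuous_intros continuous_on_subset[OF bD(2)] continuous_on_subset[OF cont])
  obtain B2 where B2: "\<And>x. x \<in> ?K \<Longrightarrow> \<bar>b x\<bar> \<le> B2"
    by (rule continuous_bounded_support[OF clK, of b 0 R])
       (auto intro: continuous_on_subset[OF bD(3)])
  have "\<bar>dvg (\<lambda>x h. b x *\<^sub>R F' x h + b' x h *\<^sub>R F x) x\<bar> \<le> \<bar>B2\<bar> * \<bar>C\<bar> + \<bar>B1\<bar>" if x: "x \<in> \<Omega>" for x
  proof (cases "x \<in> cball 0 R")
    case True
    then have K: "x \<in> ?K" using x closure_subset by auto
    have "\<bar>b x * dvg F' x + ?B x\<bar> \<le> \<bar>b x\<bar> * \<bar>dvg F' x\<bar> + \<bar>?B x\<bar>"
      by (simp add: abs_mult[symmetric] abs_triangle_ineq)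
    also have "\<dots> \<le> \<bar>B2\<bar> * \<bar>C\<bar> + \<bar>B1\<bar>"
      using B1[OF K] B2[OF K] C[OF x] by (intro add_mono mult_mono) auto
    finally show ?thesis by (simp only: dvg_scaleR)
  next
    case False
    have "F' x h = 0" for h
      by (rule C1_deriv_on_eq_0[OF C1, of "\<Omega> \<inter> - cball 0 R"])
        (use x False R assms(1) closure_subset[of \<Omega>] in auto)
    moreover have "F x = 0" using R x False closure_subset by blast
    ultimately show ?thesis by (simp add: dvg_def)
  qed
  then have "\<exists>C. \<forall>x\<in>\<Omega>. \<bar>dvg (\<lambda>x h. b x *\<^sub>R F' x h + b' x h *\<^sub>R F x) x\<bar> \<le> C" by blast
  moreover have "C1_deriv_on \<Omega> (\<lambda>x. b x *\<^sub>R F x) (\<lambda>x h. b x *\<^sub>R F' x h + b' x h *\<^sub>R F x)"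
    by (rule C1_deriv_on_scaleR[OF C1_deriv_on_subset[OF b(1)] C1]) simp
  moreover have "continuous_on (closure \<Omega>) (\<lambda>x. b x *\<^sub>R F x)"
    by (intro continuous_intros cont continuous_on_subset[OF bD(3)]) auto
  moreover have "\<exists>R. \<forall>x\<in>closure \<Omega>. x \<notin> cball 0 R \<longrightarrow> b x *\<^sub>R F x = 0"
    using R by auto
  moreover have "\<forall>p\<in>frontier \<Omega>. \<forall>r \<phi> G. local_defining_function \<Omega> p r \<phi> G \<longrightarrow> 0 \<le> (b p *\<^sub>R F p) \<bullet> G p"
    using nn b(2) by simp
  ultimately show ?thesis unfolding outward_field_def by blast
qed

lemma local_defining_function_restrict:
  assumes "local_defining_function \<Omega> p r \<phi> G" "ball x s \<subseteq> ball p r" "s > 0"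
  shows "local_defining_function \<Omega> x s \<phi> G"
proof -
  have *: "A \<inter> ball x s = {y \<in> ball x s. P y}" if "A \<inter> ball p r = {y \<in> ball p r. P y}" for A P
    using that assms(2) by blast
  show ?thesis
    using assms *[of \<Omega>] *[of "frontier \<Omega>"] unfolding local_defining_function_def
    by (auto intro: continuous_on_subset)
qed

text \<open>
  The flux of \<open>F\<close> is only nonnegative, so \<open>F\<close> is perturbed by \<open>\<delta> b a\<close> with \<open>a\<close> transversal to
  the boundary; the flux is then positive on the support of \<open>F\<close>, hence still nonnegative on
  the nearby level sets \<open>- \<epsilon>0 \<le> \<phi> < 0\<close> where the gradient of the cutoff \<open>H\<close> lives.
\<close>
lemma outward_field_nonneg_in_chart:
  assumes "open \<Omega>" and chart: "local_defining_function \<Omega> p r \<phi> G"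
    and a: "\<And>x. x \<in> ball p r \<Longrightarrow> 0 < G x \<bullet> a"
    and \<rho>: "0 < \<rho>" "2 * \<rho> < r"
    and F: "outward_field \<Omega> F F'" and supp: "\<And>x. x \<in> closure \<Omega> \<Longrightarrow> x \<notin> ball p \<rho> \<Longrightarrow> F x = 0"
  shows "0 \<le> (LINT x:\<Omega>|lborel. dvg F' x)"
proof -
  obtain b b' where b: "C1_deriv_on UNIV b b'" "\<And>x. 0 \<le> b x" "\<And>x. b x \<le> (1::real)"
    "\<And>x. x \<in> cball p \<rho> \<Longrightarrow> b x = 1" "\<And>x. x \<notin> ball p (2*\<rho>) \<Longrightarrow> b x = 0"
    using bump_function[OF \<rho>(1), of p] by blast
  from F obtain C where cont: "continuous_on (closure \<Omega>) F" and C1: "C1_deriv_on \<Omega> F F'"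
    and C: "\<And>x. x \<in> \<Omega> \<Longrightarrow> \<bar>dvg F' x\<bar> \<le> C"
    and nn: "\<And>p r \<phi> G. p \<in> frontier \<Omega> \<Longrightarrow> local_defining_function \<Omega> p r \<phi> G \<Longrightarrow> 0 \<le> F p \<bullet> G p"
    unfolding outward_field_def by blast
  from chart have contG: "continuous_on (ball p r) G"
    and d\<phi>: "\<And>x. x \<in> ball p r \<Longrightarrow> (\<phi> has_derivative (\<lambda>h. G x \<bullet> h)) (at x)"
    and ins: "\<And>x. x \<in> ball p r \<Longrightarrow> x \<in> \<Omega> \<longleftrightarrow> \<phi> x < 0"
    and fro: "\<And>x. x \<in> ball p r \<Longrightarrow> x \<in> frontier \<Omega> \<longleftrightarrow> \<phi> x = 0"
    unfolding local_defining_function_def by blast+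
  have C1\<phi>: "C1_deriv_on (ball p r) \<phi> (\<lambda>x h. G x \<bullet> h)"
    unfolding C1_deriv_on_def using d\<phi> contG by (auto intro!: continuous_intros)
  note cont\<phi> = C1_deriv_onD(3)[OF C1\<phi>]
  let ?S = "\<Omega> \<inter> ball p r"
  have oS: "open ?S" using assms(1) by auto
  have sub: "\<Omega> \<subseteq> closure \<Omega>" by (rule closure_subset)
  have cb: "cball p (2*\<rho>) \<subseteq> ball p r" "cball p \<rho> \<subseteq> ball p r"
    using \<rho> by auto
  have dF0: "dvg F' x = 0" if "x \<in> \<Omega>" "x \<notin> cball p \<rho>" for x
  proof -
    have "F' x h = 0" for h
      by (rule C1_deriv_on_eq_0[OF C1, of "\<Omega> \<inter> - cball p \<rho>"])
        (use that supp sub assms(1) in auto)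
    then show ?thesis by (simp add: dvg_def)
  qed
  define B where "B x = (\<Sum>e\<in>Basis. b' x e * (a \<bullet> e))" for x
  have contB: "continuous_on A B" for A
    unfolding B_def[abs_def] by (intro continuous_intros continuous_on_subset[OF C1_deriv_onD(2)[OF b(1)]]) auto
  have B0: "B x = 0" if "x \<notin> cball p (2*\<rho>)" for x
  proof -
    have "b' x h = 0" for h
      by (rule C1_deriv_on_eq_0[OF b(1), of "- cball p (2*\<rho>)"]) (use that b(5) in auto)
    then show ?thesis by (simp add: B_def)
  qed
  obtain CB where CB: "\<And>x. \<bar>B x\<bar> \<le> CB"
    by (rule continuous_bounded_support[OF closed_UNIV contB, of p "2*\<rho>"]) (use B0 in auto)
  have intB: "set_integrable lborel ?S B"
    by (rule set_integrable_bounded_continuous[OF oS contB CB B0])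
  have intF: "set_integrable lborel ?S (dvg F')"
    by (rule set_integrable_bounded_continuous[OF oS _ C dF0])
       (auto intro: continuous_on_subset[OF continuous_on_dvg[OF C1]])
  \<comment> \<open>The layer width \<open>\<epsilon>0\<close> depends on \<open>\<delta>\<close>,
    so the layer shrinks for fixed \<open>\<delta>\<close> first, and \<open>\<delta>\<close> tends
    to 0 only at the end.\<close>
  have main: "0 \<le> (LINT x:?S|lborel. dvg F' x) + \<delta> * (LINT x:?S|lborel. B x)" if \<delta>: "\<delta> > 0" for \<delta>
  proof -
    define Fd where "Fd x = F x + b x *\<^sub>R (\<delta> *\<^sub>R a)" for x
    define Fd' where "Fd' x h = F' x h + (b x *\<^sub>R 0 + b' x h *\<^sub>R (\<delta> *\<^sub>R a))" for x h
    have C1d: "C1_deriv_on \<Omega> Fd Fd'"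
      unfolding Fd_def[abs_def] Fd'_def[abs_def]
      by (intro C1_deriv_on_add[OF C1] C1_deriv_on_scaleR[OF C1_deriv_on_subset[OF b(1)]] C1_deriv_on_const) simp
    have dvgd: "dvg Fd' x = dvg F' x + \<delta> * B x" for x
      unfolding Fd'_def dvg_add dvg_scaleR
      by (simp add: dvg_def B_def sum_distrib_left mult_ac)
    have Fd0: "Fd x = 0" if "x \<in> closure \<Omega>" "x \<notin> cball p (2*\<rho>)" for x
    proof -
      have "x \<notin> ball p \<rho>" "x \<notin> ball p (2*\<rho>)" using that \<rho> by auto
      then show ?thesis using supp[OF that(1)] b(5)[of x] by (simp add: Fd_def)
    qed
    have contFd: "continuous_on (closure \<Omega>) Fd"
      unfolding Fd_def[abs_def] by (intro continuous_intros cont continuous_on_subset[OF C1_deriv_onD(3)[OF b(1)]]) auto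
    \<comment> \<open>On the compact set \<open>K\<close> where the perturbed flux fails to be
      positive, \<open>\<phi>\<close> is negative, hence bounded away from 0. Outside
      \<open>cball p \<rho>\<close> the perturbed field is a nonnegative multiple of
      \<open>a\<close>.\<close>
    obtain \<epsilon>0 where \<epsilon>0: "\<epsilon>0 > 0" "\<And>x. x \<in> ?S \<Longrightarrow> - \<epsilon>0 \<le> \<phi> x \<Longrightarrow> 0 \<le> G x \<bullet> Fd x"
    proof -
      define K where "K = {x \<in> cball p \<rho> \<inter> closure \<Omega>. G x \<bullet> Fd x \<le> 0}"
      have "closed K"
        unfolding K_def
        by (intro continuous_on_closed_Collect_le continuous_intros continuous_on_subset[OF contG]
            continuous_on_subset[OF contFd]) (use cb in auto)
      moreover have "bounded K" unfolding K_def by (rule bounded_subset[of "cball p \<rho>"]) auto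
      ultimately have cK: "compact K" using compact_eq_bounded_closed by blast
      have neg: "\<phi> x < 0" if "x \<in> K" for x
      proof (rule ccontr)
        assume n: "\<not> \<phi> x < 0"
        have x: "x \<in> cball p \<rho>" "x \<in> closure \<Omega>" "x \<in> ball p r" "G x \<bullet> Fd x \<le> 0"
          using that cb by (auto simp: K_def)
        then have fx: "x \<in> frontier \<Omega>"
          using n ins[of x] assms(1) by (simp add: frontier_def interior_open)
        \<comment> \<open>Restricted to a ball around \<open>x\<close>, the chart at
          \<open>p\<close> is a chart at \<open>x\<close> with the same \<open>G\<close>, so the
          flux hypothesis applies at \<open>x\<close>.\<close>
        have "ball x (r - dist p x) \<subseteq> ball p r"
          by (simp add: ball_subset_ball_iff dist_commute)
        then have "local_defining_function \<Omega> x (r - dist p x) \<phi> G"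
          by (rule local_defining_function_restrict[OF chart]) (use x(3) in auto)
        from nn[OF fx this] have "0 \<le> G x \<bullet> F x" by (simp add: inner_commute)
        moreover have "0 < \<delta> * (G x \<bullet> a)" using a[OF x(3)] \<delta> by simp
        ultimately show False
          using x(4) b(4)[OF x(1)] by (simp add: Fd_def inner_add_right)
      qed
      obtain \<epsilon> where \<epsilon>: "\<epsilon> > 0" "\<And>x. x \<in> K \<Longrightarrow> \<phi> x < - \<epsilon>"
      proof (cases "K = {}")
        case True
        then show thesis using that[of 1] by auto
      next
        case False
        obtain m where m: "m \<in> K" "\<And>x. x \<in> K \<Longrightarrow> \<phi> x \<le> \<phi> m"
          using continuous_attains_sup[OF cK False continuous_on_subset[OF cont\<phi>]] cb
          unfolding K_def by blast
        show thesis
        proof (rule that[of "- \<phi> m / 2"])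
          show "0 < - \<phi> m / 2" using neg[OF m(1)] by simp
          show "\<phi> x < - (- \<phi> m / 2)" if "x \<in> K" for x
            using m(2)[OF that] neg[OF m(1)] by simp
        qed
      qed
      show thesis
      proof (rule that[OF \<epsilon>(1)])
        fix x assume x: "x \<in> ?S" "- \<epsilon> \<le> \<phi> x"
        show "0 \<le> G x \<bullet> Fd x"
        proof (cases "x \<in> cball p \<rho>")
          case True
          then show ?thesis using x \<epsilon>(2)[of x] sub by (force simp: K_def)
        next
          case False
          then have "F x = 0" using supp x(1) sub by auto
          moreover have "0 < G x \<bullet> a" using a x(1) by simp
          ultimately show ?thesis using \<delta> b(2)[of x] by (simp add: Fd_def)
        qed
      qed
    qed
    \<comment> \<open>\<open>H \<epsilon>\<close> is 0 where \<phi> \<ge> -\<epsilon> and 1 where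
      \<phi> \<le> -2\<epsilon>, so it varies only in the layer between.\<close>
    define H where "H \<epsilon> x = 1 - cutoff (- \<phi> x / \<epsilon> - 1)" for \<epsilon> x
    have H01: "0 \<le> H \<epsilon> x" "H \<epsilon> x \<le> 1" for \<epsilon> x
      using cutoff_nonneg cutoff_le_1 by (simp_all add: H_def)
    have contH: "continuous_on ?S (H \<epsilon>)" for \<epsilon>
      unfolding H_def[abs_def] divide_inverse
      by (intro continuous_intros continuous_on_subset[OF cont\<phi>]) auto
    have contD: "continuous_on ?S (dvg Fd')"
      by (rule continuous_on_subset[OF continuous_on_dvg[OF C1d]]) auto
    have D0: "dvg Fd' x = 0" if "x \<in> \<Omega>" "x \<notin> cball p (2*\<rho>)" for x
      using dF0[OF that(1)] B0[OF that(2)] that \<rho> by (auto simp: dvgd)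
    have CD: "\<bar>dvg Fd' x\<bar> \<le> C + \<delta> * CB" if "x \<in> \<Omega>" for x
    proof -
      have "\<bar>dvg Fd' x\<bar> \<le> \<bar>dvg F' x\<bar> + \<delta> * \<bar>B x\<bar>"
        unfolding dvgd using \<delta> abs_triangle_ineq[of "dvg F' x" "\<delta> * B x"] by (simp add: abs_mult)
      also have "\<dots> \<le> C + \<delta> * CB" using C[OF that] CB[of x] \<delta> by (intro add_mono mult_left_mono) auto
      finally show ?thesis .
    qed
    have intD: "set_integrable lborel ?S (dvg Fd')"
      by (rule set_integrable_bounded_continuous[OF oS contD CD D0]) auto
    have HD: "\<bar>H \<epsilon> x * dvg Fd' x\<bar> \<le> \<bar>dvg Fd' x\<bar>" for \<epsilon> x
      using H01[of \<epsilon> x] by (simp add: abs_mult mult_left_le_one_le)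
    have intHD: "set_integrable lborel ?S (\<lambda>x. H \<epsilon> x * dvg Fd' x)" for \<epsilon>
      by (rule set_integrable_bounded_continuous[OF oS continuous_on_mult[OF contH contD] order.trans[OF HD CD]])
         (use D0 in auto)
    have step: "0 \<le> (LINT x:?S|lborel. H \<epsilon> x * dvg Fd' x)" if \<epsilon>: "0 < \<epsilon>" "2 * \<epsilon> \<le> \<epsilon>0" for \<epsilon>
    proof -
      define H' where "H' x h = cutoff' (- \<phi> x / \<epsilon> - 1) / \<epsilon> * (G x \<bullet> h)" for x h
      have "((\<lambda>t. 1 - cutoff (- t / \<epsilon> - 1)) has_real_derivative cutoff' (- t / \<epsilon> - 1) / \<epsilon>) (at t)" for t
        using \<epsilon> by (auto intro!: derivative_eq_intros DERIV_chain2[OF DERIV_cutoff])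
      moreover have "continuous_on ?S (\<lambda>x. cutoff' (- \<phi> x / \<epsilon> - 1) / \<epsilon>)"
        using \<epsilon> by (intro continuous_intros continuous_on_subset[OF cont\<phi>]) auto
      ultimately have "C1_deriv_on ?S (\<lambda>x. 1 - cutoff (- \<phi> x / \<epsilon> - 1))
          (\<lambda>x h. cutoff' (- \<phi> x / \<epsilon> - 1) / \<epsilon> * (G x \<bullet> h))"
        by (intro C1_deriv_on_compose[OF C1_deriv_on_subset[OF C1\<phi>]]) auto
      then have C1H: "C1_deriv_on ?S (H \<epsilon>) H'"
        unfolding H_def[abs_def] H'_def[abs_def] .
      define E' where "E' x h = H \<epsilon> x *\<^sub>R Fd' x h + H' x h *\<^sub>R Fd x" for x h
      have C1E: "C1_deriv_on ?S (\<lambda>x. H \<epsilon> x *\<^sub>R Fd x) E'"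
        unfolding E'_def[abs_def] by (intro C1_deriv_on_scaleR C1H C1_deriv_on_subset[OF C1d]) auto
      \<comment> \<open>\<open>H \<epsilon>\<close> removes the field next to the boundary, and
        \<open>Fd\<close> vanishes outside \<open>cball p (2*\<rho>)\<close>; what is left has
        compact support inside the open set \<open>?S\<close>.\<close>
      define K where "K = {x \<in> cball p (2*\<rho>). \<phi> x \<le> - \<epsilon>}"
      have "closed K" unfolding K_def
        by (intro continuous_on_closed_Collect_le continuous_intros continuous_on_subset[OF cont\<phi>]) (use cb in auto)
      moreover have "bounded K" unfolding K_def by (rule bounded_subset[of "cball p (2*\<rho>)"]) auto
      ultimately have cK: "compact K" using compact_eq_bounded_closed by blast
      have KS: "K \<subseteq> ?S"
      proof
        fix x assume "x \<in> K"
        then have "x \<in> ball p r" "\<phi> x < 0" using cb \<epsilon> by (auto simp: K_def)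
        then show "x \<in> ?S" using ins by auto
      qed
      have E0: "H \<epsilon> x *\<^sub>R Fd x = 0" if "x \<in> ?S" "x \<notin> K" for x
      proof (cases "x \<in> cball p (2*\<rho>)")
        case True
        then have "- \<phi> x < \<epsilon>" using that by (auto simp: K_def)
        then have "- \<phi> x / \<epsilon> - 1 \<le> 0" using \<epsilon> by (simp add: field_simps)
        then show ?thesis using cutoff_eq_1 by (simp add: H_def)
      next
        case False
        then show ?thesis using Fd0 that sub by auto
      qed
      note B = integral_dvg_compact_support[OF oS C1E cK KS E0]
      \<comment> \<open>The gradient of \<open>H \<epsilon>\<close> is a nonpositive multiple of
        \<open>G\<close>, supported in the layer where the flux of \<open>Fd\<close> is nonnegative.
        Dropping this term can only increase the right side, and the left side integrates to
        0.\<close>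
      have "dvg E' x \<le> H \<epsilon> x * dvg Fd' x" if x: "x \<in> ?S" for x
      proof -
        let ?w = "cutoff' (- \<phi> x / \<epsilon> - 1) / \<epsilon>"
        have "dvg E' x = H \<epsilon> x * dvg Fd' x + ?w * (G x \<bullet> Fd x)"
          unfolding E'_def dvg_scaleR H'_def
          by (subst euclidean_inner[of "G x" "Fd x"]) (simp only: sum_distrib_left mult.assoc)
        moreover have "?w * (G x \<bullet> Fd x) \<le> 0"
        proof (cases "- \<phi> x / \<epsilon> - 1 < 1")
          case True
          then have "- \<epsilon>0 \<le> \<phi> x" using \<epsilon> by (simp add: field_simps)
          moreover have "?w \<le> 0" using cutoff'_nonpos \<epsilon> by (simp add: divide_le_0_iff)
          ultimately show ?thesis using \<epsilon>0(2)[OF x] by (intro mult_nonpos_nonneg) auto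
        next
          case False
          then show ?thesis using cutoff'_eq_0_right by simp
        qed
        ultimately show ?thesis by simp
      qed
      then have "(LINT x:?S|lborel. dvg E' x) \<le> (LINT x:?S|lborel. H \<epsilon> x * dvg Fd' x)"
        by (intro set_integral_mono B(1) intHD) auto
      then show ?thesis using B(2) by simp
    qed
    define e where "e n = \<epsilon>0 / 2 / real (Suc n)" for n
    have e: "0 < e n" "2 * e n \<le> \<epsilon>0" for n
      using \<epsilon>0(1) by (auto simp: e_def field_simps)
    have "(\<lambda>n. LINT x:?S|lborel. H (e n) x * dvg Fd' x) \<longlonglongrightarrow> (LINT x:?S|lborel. dvg Fd' x)"
      unfolding set_lebesgue_integral_def
    proof (rule integral_dominated_convergence)
      show "integrable lborel (\<lambda>x. \<bar>indicator ?S x *\<^sub>R dvg Fd' x\<bar>)"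
        using intD by (intro integrable_abs) (simp add: set_integrable_def)
      show "(\<lambda>x. indicator ?S x *\<^sub>R dvg Fd' x) \<in> borel_measurable lborel"
        using intD unfolding set_integrable_def by (rule borel_measurable_integrable)
      show "(\<lambda>x. indicator ?S x *\<^sub>R (H (e n) x * dvg Fd' x)) \<in> borel_measurable lborel" for n
        using intHD unfolding set_integrable_def by (rule borel_measurable_integrable)
      show "AE x in lborel. norm (indicator ?S x *\<^sub>R (H (e n) x * dvg Fd' x)) \<le> \<bar>indicator ?S x *\<^sub>R dvg Fd' x\<bar>" for n
        using HD by (auto simp: indicator_def)
      show "AE x in lborel. (\<lambda>n. indicator ?S x *\<^sub>R (H (e n) x * dvg Fd' x)) \<longlonglongrightarrow> indicator ?S x *\<^sub>R dvg Fd' x"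
      proof (intro always_eventually allI)
        fix x
        show "(\<lambda>n. indicator ?S x *\<^sub>R (H (e n) x * dvg Fd' x)) \<longlonglongrightarrow> indicator ?S x *\<^sub>R dvg Fd' x"
        proof (cases "x \<in> ?S")
          case True
          then have neg: "\<phi> x < 0" using ins by auto
          have "e \<longlonglongrightarrow> 0"
            unfolding e_def[abs_def] divide_inverse
            by (rule tendsto_mult_right_zero[OF LIMSEQ_inverse_real_of_nat])
          then have "\<forall>\<^sub>F n in sequentially. e n < - \<phi> x / 2"
            using neg by (intro order_tendstoD(2)) auto
          then have "\<forall>\<^sub>F n in sequentially. H (e n) x = 1"
          proof eventually_elim
            case (elim n)
            then have "1 \<le> - \<phi> x / e n - 1" using e(1)[of n] by (simp add: field_simps)
            then show ?case by (simp add: H_def cutoff_eq_0)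
          qed
          then have "\<forall>\<^sub>F n in sequentially. indicator ?S x *\<^sub>R (H (e n) x * dvg Fd' x) = indicator ?S x *\<^sub>R dvg Fd' x"
            by eventually_elim simp
          then show ?thesis by (rule tendsto_eventually)
        qed simp
      qed
    qed
    then have "0 \<le> (LINT x:?S|lborel. dvg Fd' x)"
      by (rule LIMSEQ_le_const) (use step e in auto)
    also have "\<dots> = (LINT x:?S|lborel. dvg F' x) + \<delta> * (LINT x:?S|lborel. B x)"
      using intF intB by (simp add: dvgd set_integral_add)
    finally show ?thesis .
  qed
  have "0 \<le> (LINT x:?S|lborel. dvg F' x)"
  proof (rule tendsto_lowerbound)
    show "((\<lambda>\<delta>. (LINT x:?S|lborel. dvg F' x) + \<delta> * (LINT x:?S|lborel. B x)) \<longlongrightarrow> (LINT x:?S|lborel. dvg F' x)) (at_right 0)"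
      by (auto intro!: tendsto_eq_intros)
    show "\<forall>\<^sub>F \<delta> in at_right 0. 0 \<le> (LINT x:?S|lborel. dvg F' x) + \<delta> * (LINT x:?S|lborel. B x)"
      using main by (auto simp: eventually_at_filter)
  qed simp
  also have "\<dots> = (LINT x:\<Omega>|lborel. dvg F' x)"
    unfolding set_lebesgue_integral_def
    by (intro Bochner_Integration.integral_cong) (use dF0 \<rho> in \<open>auto simp: indicator_def\<close>)
  finally show ?thesis .
qed

text \<open>Finitely many balls on which a local version holds cover the bounded set outside which
  \<open>F\<close> vanishes. Splitting \<open>F\<close> into b F and (1 - b) F removes one ball at a
  time, so induction on the cover replaces a normalised partition of unity.\<close>

theorem signed_divergence_theorem:
  assumes "open \<Omega>" "C1_boundary \<Omega>" "outward_field \<Omega> F F'"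
  shows "0 \<le> (LINT x:\<Omega>|lborel. dvg F' x)"
proof -
  have sub: "\<Omega> \<subseteq> closure \<Omega>" by (rule closure_subset)
  \<comment> \<open>Fields may live on radius \<open>2*\<rho>\<close>, while the cover will use
    radius \<open>\<rho>\<close>; the bump function descends from 1 to 0 in the gap.\<close>
  have "\<exists>\<rho>>0. \<forall>F F'. outward_field \<Omega> F F' \<and> (\<forall>x\<in>closure \<Omega>. x \<notin> ball p (2*\<rho>) \<longrightarrow> F x = 0)
          \<longrightarrow> 0 \<le> (LINT x:\<Omega>|lborel. dvg F' x)" if "p \<in> closure \<Omega>" for p
  proof (cases "p \<in> \<Omega>")
    case True
    then obtain e where e: "e > 0" "cball p e \<subseteq> \<Omega>"
      using assms(1) open_contains_cball by blast
    show ?thesis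
    proof (intro exI[of _ "e/2"] conjI allI impI)
      fix F F' assume *: "outward_field \<Omega> F F' \<and> (\<forall>x\<in>closure \<Omega>. x \<notin> ball p (2*(e/2)) \<longrightarrow> F x = 0)"
      then have "C1_deriv_on \<Omega> F F'" by (simp add: outward_field_def)
      moreover have "F x = 0" if "x \<in> \<Omega>" "x \<notin> cball p e" for x
        using * that sub by auto
      ultimately have "(LINT x:\<Omega>|lborel. dvg F' x) = 0"
        by (rule integral_dvg_compact_support(2)[OF assms(1) _ compact_cball e(2)])
      then show "0 \<le> (LINT x:\<Omega>|lborel. dvg F' x)" by simp
    qed (use e in simp)
  next
    case False
    then have "p \<in> frontier \<Omega>" using that assms(1) by (simp add: frontier_def interior_open)
    then obtain r \<phi> G where ch: "local_defining_function \<Omega> p r \<phi> G"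
      using assms(2) unfolding C1_boundary_def by blast
    then have r: "r > 0" and contG: "continuous_on (ball p r) G" and "G p \<noteq> 0"
      by (auto simp: local_defining_function_def)
    \<comment> \<open>The constant vector \<open>G p\<close> serves as the transversal direction
      \<open>a\<close>; continuity of \<open>G\<close> keeps it outward on a smaller ball.\<close>
    have "continuous (at p) (\<lambda>x. G x \<bullet> G p)"
      using contG r by (intro continuous_intros) (simp add: continuous_on_eq_continuous_at)
    moreover have "0 < G p \<bullet> G p" using \<open>G p \<noteq> 0\<close> by simp
    ultimately have "\<forall>\<^sub>F x in nhds p. 0 < G x \<bullet> G p"
      unfolding continuous_at tendsto_at_iff_tendsto_nhds[of "\<lambda>x. G x \<bullet> G p"] by (rule order_tendstoD(1))
    then obtain s where s: "s > 0" "\<And>x. dist x p < s \<Longrightarrow> 0 < G x \<bullet> G p"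
      unfolding eventually_nhds_metric by blast
    define r' where "r' = min r s"
    have r': "r' > 0" and pos: "\<And>x. x \<in> ball p r' \<Longrightarrow> 0 < G x \<bullet> G p"
      using r s by (auto simp: r'_def dist_commute)
    have ch': "local_defining_function \<Omega> p r' \<phi> G"
      by (rule local_defining_function_restrict[OF ch]) (use r' in \<open>auto simp: r'_def\<close>)
    \<comment> \<open>The local radius 2 * (r'/6) equals r'/3, whose double is still below
      \<open>r'\<close>, as the chart lemma requires.\<close>
    show ?thesis
      by (intro exI[of _ "r'/6"])
         (use outward_field_nonneg_in_chart[OF assms(1) ch' pos, of "r'/3"] r' in auto)
  qed
  then obtain \<rho> where \<rho>: "\<And>p. p \<in> closure \<Omega> \<Longrightarrow> \<rho> p > 0"
    and loc: "\<And>p F F'. p \<in> closure \<Omega> \<Longrightarrow> outward_field \<Omega> F F' \<Longrightarrow>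
       (\<And>x. x \<in> closure \<Omega> \<Longrightarrow> x \<notin> ball p (2 * \<rho> p) \<Longrightarrow> F x = 0) \<Longrightarrow> 0 \<le> (LINT x:\<Omega>|lborel. dvg F' x)"
    by metis
  have ind: "0 \<le> (LINT x:\<Omega>|lborel. dvg F' x)"
    if "finite P" "P \<subseteq> closure \<Omega>" "outward_field \<Omega> F F'"
      "\<And>x. x \<in> closure \<Omega> \<Longrightarrow> x \<notin> (\<Union>p\<in>P. ball p (\<rho> p)) \<Longrightarrow> F x = 0" for P F F'
    using that
  proof (induction P arbitrary: F F' rule: finite_induct)
    case empty
    have C1: "C1_deriv_on \<Omega> F F'" using empty.prems by (simp add: outward_field_def)
    have "F' x h = 0" if "x \<in> \<Omega>" for x h
      by (rule C1_deriv_on_eq_0[OF C1 assms(1) that that]) (use empty.prems sub in auto)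
    then have "dvg F' x = 0" if "x \<in> \<Omega>" for x
      using that by (simp add: dvg_def)
    then have "(LINT x:\<Omega>|lborel. dvg F' x) = (LINT x:\<Omega>|lborel. 0)"
      using assms(1) by (intro set_lebesgue_integral_cong) auto
    then show ?case by simp
  next
    case (insert p P)
    have p: "p \<in> closure \<Omega>" using insert.prems by simp
    \<comment> \<open>b F lives in the ball of radius \<open>2 * \<rho> p\<close> and is handled by
      \<open>loc\<close>; (1 - b) F vanishes on \<open>ball p (\<rho> p)\<close>, so the balls of
      \<open>P\<close> alone suffice for it.\<close>
    obtain b b' where b: "C1_deriv_on UNIV b b'" "\<And>x. 0 \<le> b x" "\<And>x. b x \<le> (1::real)"
      "\<And>x. x \<in> cball p (\<rho> p) \<Longrightarrow> b x = 1" "\<And>x. x \<notin> ball p (2 * \<rho> p) \<Longrightarrow> b x = 0"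
      using bump_function[OF \<rho>[OF p], of p] by blast
    have c: "C1_deriv_on UNIV (\<lambda>x. 1 - b x) (\<lambda>x h. - b' x h)"
      using b(1) unfolding C1_deriv_on_def by (auto intro!: derivative_eq_intros continuous_intros)
    note o1 = outward_field_scaleR[OF assms(1) insert.prems(2) b(1,2)]
    have o2: "outward_field \<Omega> (\<lambda>x. (1 - b x) *\<^sub>R F x) (\<lambda>x h. (1 - b x) *\<^sub>R F' x h + - b' x h *\<^sub>R F x)"
      by (rule outward_field_scaleR[OF assms(1) insert.prems(2) c]) (simp add: b(3))
    have "0 \<le> (LINT x:\<Omega>|lborel. dvg (\<lambda>x h. b x *\<^sub>R F' x h + b' x h *\<^sub>R F x) x)"
      by (rule loc[OF p o1]) (simp add: b(5))
    moreover have "0 \<le> (LINT x:\<Omega>|lborel. dvg (\<lambda>x h. (1 - b x) *\<^sub>R F' x h + - b' x h *\<^sub>R F x) x)"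
    proof (rule insert.IH[OF _ o2])
      show "P \<subseteq> closure \<Omega>" using insert.prems by simp
      fix x assume x: "x \<in> closure \<Omega>" "x \<notin> (\<Union>p\<in>P. ball p (\<rho> p))"
      show "(1 - b x) *\<^sub>R F x = 0"
        using insert.prems(3)[OF x(1)] x(2) b(4)[of x] by (cases "x \<in> ball p (\<rho> p)") auto
    qed
    moreover have "dvg F' x = dvg (\<lambda>x h. b x *\<^sub>R F' x h + b' x h *\<^sub>R F x) x
        + dvg (\<lambda>x h. (1 - b x) *\<^sub>R F' x h + - b' x h *\<^sub>R F x) x" for x
      unfolding dvg_scaleR by (simp add: algebra_simps sum_negf)
    ultimately show ?case
      using set_integral_add(2)[OF set_integrable_dvg[OF assms(1) o1] set_integrable_dvg[OF assms(1) o2]]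
      by simp
  qed
  obtain R where R: "\<And>x. x \<in> closure \<Omega> \<Longrightarrow> x \<notin> cball 0 R \<Longrightarrow> F x = 0"
    using assms(3) unfolding outward_field_def by blast
  have "compact (closure \<Omega> \<inter> cball 0 R)" by (intro closed_Int_compact) auto
  moreover have "closure \<Omega> \<inter> cball 0 R \<subseteq> (\<Union>p\<in>closure \<Omega>. ball p (\<rho> p))"
    using \<rho> by fastforce
  ultimately obtain P where "P \<subseteq> closure \<Omega>" "finite P" "closure \<Omega> \<inter> cball 0 R \<subseteq> (\<Union>p\<in>P. ball p (\<rho> p))"
    by (rule compactE_image[where f = "\<lambda>p. ball p (\<rho> p)", OF _ open_ball])
  then show ?thesis
    using R by (intro ind[OF _ _ assms(3)]) blast+
qed

section \<open>The weighted stress identity and the decay argument\<close>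

definition stress_field :: "real^3 \<Rightarrow> (real^3 \<Rightarrow> real^3) \<Rightarrow> real^3 \<Rightarrow> real^3" where
  "stress_field x0 u x = (u x \<bullet> (x - x0)) *\<^sub>R u x + (- (1/2) * (u x \<bullet> u x)) *\<^sub>R (x - x0)"

text \<open>The boundary conditions enter only through the sign \<open>bd\<close>. A point
  \<open>y\<close> with u y \<noteq> 0 contributes at least \<open>m * vK\<close>, independently of
  \<open>L\<close>, whereas the cutoff error is at most
  \<open>128 * \<epsilon>\<^sup>2 * \<omega>\<close>; fixing \<open>\<epsilon>\<close> before
  \<open>L\<close> gives a contradiction.\<close>

lemma vanishing_of_stress_identity:
  fixes \<Omega> :: "(real^3) set" and u :: "real^3 \<Rightarrow> real^3"
  assumes "open \<Omega>" "C1_boundary \<Omega>" and contu: "continuous_on (closure \<Omega>) u"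
    and C1V: "C1_deriv_on \<Omega> (stress_field x0 u) V'"
    and dV: "\<And>x. x \<in> \<Omega> \<Longrightarrow> dvg V' x = - (1/2) * (u x \<bullet> u x)"
    and bd: "\<And>p r \<phi> G. p \<in> frontier \<Omega> \<Longrightarrow> local_defining_function \<Omega> p r \<phi> G \<Longrightarrow>
               0 \<le> stress_field x0 u p \<bullet> G p"
    and decay: "\<And>\<epsilon>. \<epsilon> > 0 \<Longrightarrow> \<exists>R. \<forall>x\<in>\<Omega>. norm (x - x0) \<ge> R \<longrightarrow> norm (x - x0) * norm (u x) \<le> \<epsilon>"
  shows "\<forall>x\<in>\<Omega>. u x = 0"
proof (rule ccontr)
  assume "\<not> ?thesis"
  then obtain y where y: "y \<in> \<Omega>" "u y \<noteq> 0" by blast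
  have sub: "\<Omega> \<subseteq> closure \<Omega>" by (rule closure_subset)
  define \<mu> where "\<mu> = u y \<bullet> u y"
  have \<mu>: "\<mu> > 0" using y by (simp add: \<mu>_def)
  obtain s where s: "s > 0" "cball y s \<subseteq> \<Omega>" "\<And>x. x \<in> cball y s \<Longrightarrow> \<mu> / 2 \<le> u x \<bullet> u x"
  proof -
    have "open {x \<in> \<Omega>. \<mu> / 2 < u x \<bullet> u x}"
    proof -
      have "continuous_on \<Omega> (\<lambda>x. u x \<bullet> u x)"
        by (intro continuous_intros continuous_on_subset[OF contu] sub)
      then have "open (\<Omega> \<inter> (\<lambda>x. u x \<bullet> u x) -` {\<mu> / 2<..})"
        by (rule continuous_open_preimage) (use assms(1) in auto)
      moreover have "\<Omega> \<inter> (\<lambda>x. u x \<bullet> u x) -` {\<mu> / 2<..} = {x \<in> \<Omega>. \<mu> / 2 < u x \<bullet> u x}"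
        by auto
      ultimately show ?thesis by simp
    qed
    moreover have "y \<in> {x \<in> \<Omega>. \<mu> / 2 < u x \<bullet> u x}" using y \<mu> by (simp add: \<mu>_def)
    ultimately obtain s where "s > 0" "cball y s \<subseteq> {x \<in> \<Omega>. \<mu> / 2 < u x \<bullet> u x}"
      by (meson open_contains_cball)
    then show thesis by (intro that[of s]) force+
  qed
  \<comment> \<open>\<open>cball y s\<close> lies within distance \<open>RK\<close> of
    \<open>x0\<close>. As \<open>w\<close> is decreasing, \<open>m\<close> bounds the weighted |u|^2
    from below on that ball.\<close>
  define RK where "RK = norm (y - x0) + s"
  define w where "w t = 1 / ((1 + t) * sqrt (1 + t))" for t :: real
  define m where "m = w (RK\<^sup>2) * (\<mu> / 2)"
  have m: "m > 0"
    using \<mu> by (simp add: m_def w_def add_pos_nonneg)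
  define vK where "vK = measure lborel (cball y s)"
  define \<omega> :: real where "\<omega> = unit_ball_vol (real DIM(real^3))"
  have vK: "vK > 0" using s(1) by (simp add: vK_def content_cball_pos)
  have \<omega>: "\<omega> \<ge> 0" by (simp add: \<omega>_def)
  \<comment> \<open>This makes the total error \<open>m * vK * (\<omega> / (\<omega> + 1))\<close>,
    strictly below \<open>m * vK\<close>. The added 1 keeps the denominator positive from \<omega>
    \<ge> 0 alone.\<close>
  define \<epsilon> where "\<epsilon> = sqrt (m * vK / (128 * (\<omega> + 1)))"
  have \<epsilon>2: "\<epsilon>\<^sup>2 = m * vK / (128 * (\<omega> + 1))" and \<epsilon>: "\<epsilon> > 0"
    using m vK \<omega> by (simp_all add: \<epsilon>_def)
  obtain R1 where R1: "\<And>x. x \<in> \<Omega> \<Longrightarrow> R1 \<le> norm (x - x0) \<Longrightarrow> norm (x - x0) * norm (u x) \<le> \<epsilon>"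
    using decay[OF \<epsilon>] by blast
  \<comment> \<open>Beyond \<open>R1\<close> the decay bound holds, \<open>RK\<close> keeps the ball
    around \<open>y\<close> where the cutoff is 1, and 1 makes \<open>L\<close> positive.\<close>
  define L where "L = max 1 (max R1 RK)"
  have L: "L > 0" "R1 \<le> L" "RK \<le> L" by (auto simp: L_def)
  have RK: "RK \<ge> 0" using s(1) by (simp add: RK_def)
  define q where "q x = (x - x0) \<bullet> (x - x0)" for x
  \<comment> \<open>In the variable t = |X|^2 the descent runs from L^2 to 2 L^2, hence inside
    \<open>cball x0 (2 * L)\<close>.\<close>
  define k where "k t = cutoff (t / L\<^sup>2 - 1)" for t
  define k' where "k' t = cutoff' (t / L\<^sup>2 - 1)" for t
  define e where "e t = k t / sqrt (1 + t)" for t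
  define e' where "e' t = k' t / (L\<^sup>2 * sqrt (1 + t)) - k t / (2 * (1 + t) * sqrt (1 + t))" for t
  have q0: "q x \<ge> 0" for x by (simp add: q_def)
  have qn: "q x = (norm (x - x0))\<^sup>2" for x by (simp add: q_def power2_norm_eq_inner)
  have k0: "k t \<ge> 0" for t by (simp add: k_def cutoff_nonneg)
  have k'0: "k' t \<le> 0" for t by (simp add: k'_def cutoff'_nonpos)
  have k1: "k t = 1" "k' t = 0" if "t \<le> L\<^sup>2" for t
    using that L by (simp_all add: k_def k'_def cutoff_eq_1 cutoff'_eq_0_left divide_le_eq_1)
  have k2: "k t = 0" "k' t = 0" if "t \<ge> 2 * L\<^sup>2" for t
  proof -
    have "1 \<le> t / L\<^sup>2 - 1" using that L by (simp add: le_divide_eq)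
    then show "k t = 0" "k' t = 0" by (simp_all add: k_def k'_def cutoff_eq_0 cutoff'_eq_0_right)
  qed
  have e0: "e (q x) \<ge> 0" for x
    using q0 k0 by (simp add: e_def)
  have e'0: "e' (q x) \<le> 0" for x
  proof -
    have "k' (q x) / (L\<^sup>2 * sqrt (1 + q x)) \<le> 0"
      using k'0 q0[of x] by (intro divide_nonpos_nonneg) auto
    moreover have "0 \<le> k (q x) / (2 * (1 + q x) * sqrt (1 + q x))"
      using k0 q0[of x] by (intro divide_nonneg_nonneg) auto
    ultimately show ?thesis by (simp add: e'_def)
  qed
  have de: "(e has_real_derivative e' t) (at t)" if "t \<ge> 0" for t
  proof -
    have s: "sqrt (1 + t) * sqrt (1 + t) = 1 + t" "sqrt (1 + t) > 0" using that by auto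
    have "(k has_real_derivative k' t * (1 / L\<^sup>2)) (at t)"
      unfolding k_def[abs_def] k'_def
      using DERIV_diff[OF DERIV_cdivide[OF DERIV_ident, of "L\<^sup>2"] DERIV_const]
      by (intro DERIV_chain2[OF DERIV_cutoff]) simp
    moreover have "((\<lambda>t. sqrt (1 + t)) has_real_derivative inverse (sqrt (1 + t)) / 2) (at t)"
      using that by (auto intro!: derivative_eq_intros)
    ultimately have "((\<lambda>t. k t / sqrt (1 + t)) has_real_derivative
        (k' t * (1 / L\<^sup>2) * sqrt (1 + t) - k t * (inverse (sqrt (1 + t)) / 2)) / (sqrt (1 + t) * sqrt (1 + t))) (at t)"
      using s by (intro DERIV_divide) auto
    moreover have "(k' t * (1 / L\<^sup>2) * sqrt (1 + t) - k t * (inverse (sqrt (1 + t)) / 2)) / (sqrt (1 + t) * sqrt (1 + t)) = e' t"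
    proof -
      have "(a * (1 / L\<^sup>2) * S - b * (inverse S / 2)) / (S * S) = a / (L\<^sup>2 * S) - b / (2 * (S * S) * S)"
        if "S > 0" for a b S :: real
        using that L by (simp add: field_simps)
      from this[OF s(2)] show ?thesis unfolding s(1) e'_def .
    qed
    ultimately show ?thesis unfolding e_def[abs_def] by simp
  qed
  have C1q: "C1_deriv_on \<Omega> q (\<lambda>x h. 2 * ((x - x0) \<bullet> h))"
    unfolding C1_deriv_on_def q_def
    by (auto intro!: derivative_eq_intros continuous_intros simp: inner_commute)
  have conte': "continuous_on A (\<lambda>x. e' (q x))" for A
    unfolding e'_def k_def k'_def divide_inverse using L q0
    by (intro continuous_intros)
       (auto simp: q_def add_nonneg_eq_0_iff intro!: continuous_intros)
  have conte: "continuous_on A (\<lambda>x. e (q x))" for A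
    unfolding e_def k_def divide_inverse using q0
    by (intro continuous_intros)
       (auto simp: q_def add_nonneg_eq_0_iff intro!: continuous_intros)
  define F where "F x = e (q x) *\<^sub>R stress_field x0 u x" for x
  define F' where "F' x h = e (q x) *\<^sub>R V' x h + (e' (q x) * (2 * ((x - x0) \<bullet> h))) *\<^sub>R stress_field x0 u x" for x h
  have C1F: "C1_deriv_on \<Omega> F F'"
    unfolding F_def[abs_def] F'_def[abs_def]
    by (intro C1_deriv_on_scaleR C1V C1_deriv_on_compose[OF C1q] de q0 conte')
  \<comment> \<open>This closed form of the divergence contains no derivative of \<open>u\<close>,
    so it is continuous up to the boundary. That yields the bound demanded by
    \<open>outward_field\<close>.\<close>
  define DF where "DF x = e (q x) * (- (1/2) * (u x \<bullet> u x)) +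
      2 * e' (q x) * ((u x \<bullet> (x - x0))\<^sup>2 - (1/2) * (u x \<bullet> u x) * q x)" for x
  have dF: "dvg F' x = DF x" if "x \<in> \<Omega>" for x
  proof -
    have "(\<Sum>b\<in>Basis. e' (q x) * (2 * ((x - x0) \<bullet> b)) * (stress_field x0 u x \<bullet> b))
        = 2 * e' (q x) * ((x - x0) \<bullet> stress_field x0 u x)"
      by (subst euclidean_inner[of "x - x0" "stress_field x0 u x"])
         (simp add: sum_distrib_left mult_ac)
    also have "(x - x0) \<bullet> stress_field x0 u x = (u x \<bullet> (x - x0))\<^sup>2 - (1/2) * (u x \<bullet> u x) * q x"
      unfolding stress_field_def q_def inner_add_right inner_scaleR_right
      by (simp add: inner_commute power2_eq_square)
    finally show ?thesis
      unfolding F'_def dvg_scaleR dV[OF that] DF_def by simp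
  qed
  have qfar: "q x \<ge> 2 * L\<^sup>2" if "x \<notin> cball x0 (2 * L)" for x
  proof -
    have "(2 * L)\<^sup>2 \<le> (norm (x - x0))\<^sup>2"
      using that L by (intro power_mono) (auto simp: dist_norm norm_minus_commute)
    moreover have "(2 * L)\<^sup>2 = 4 * L\<^sup>2" by (simp add: power_mult_distrib)
    ultimately show ?thesis using zero_le_power2[of L] unfolding qn by linarith
  qed
  have cont_stress: "continuous_on (closure \<Omega>) (stress_field x0 u)"
    unfolding stress_field_def[abs_def] by (intro continuous_intros contu)
  have "continuous_on (closure \<Omega>) DF"
    unfolding DF_def[abs_def] by (intro continuous_intros contu conte conte') (auto simp: q_def intro!: continuous_intros)
  moreover have "DF x = 0" if "x \<notin> cball x0 (2 * L)" for x
    using k2[OF qfar[OF that]] by (simp add: DF_def e_def e'_def)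
  ultimately obtain C where C: "\<And>x. x \<in> closure \<Omega> \<Longrightarrow> \<bar>DF x\<bar> \<le> C"
    using continuous_bounded_support[OF closed_closure, of \<Omega> DF x0 "2 * L"] by metis
  have out: "outward_field \<Omega> F F'"
    unfolding outward_field_def
  proof (intro conjI C1F ballI allI impI)
    show "continuous_on (closure \<Omega>) F"
      unfolding F_def[abs_def] by (intro continuous_intros conte cont_stress)
    show "\<exists>C. \<forall>x\<in>\<Omega>. \<bar>dvg F' x\<bar> \<le> C" using C dF sub by auto
    show "\<exists>R. \<forall>x\<in>closure \<Omega>. x \<notin> cball 0 R \<longrightarrow> F x = 0"
    proof (intro exI ballI impI)
      fix x :: "real^3" assume "x \<notin> cball 0 (norm x0 + 2 * L)"
      then have "x \<notin> cball x0 (2 * L)"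
        using norm_triangle_ineq2[of x x0] by (auto simp: dist_norm norm_minus_commute)
      from k2(1)[OF qfar[OF this]] show "F x = 0" by (simp add: F_def e_def)
    qed
    fix p r \<phi> G assume "p \<in> frontier \<Omega>" "local_defining_function \<Omega> p r \<phi> G"
    from bd[OF this] show "0 \<le> F p \<bullet> G p" using e0 by (simp add: F_def)
  qed
  \<comment> \<open>On the annulus q \<le> 2 L^2, |k'| \<le> 4, 1/sqrt (1 + q) \<le> 1/L and |u|^2
    \<le> \<epsilon>^2/L^2. Together with the factor 2 / L^2 of the error term they multiply to 16
    \<epsilon>^2/L^3.\<close>
  define c where "c = 16 * \<epsilon>\<^sup>2 / L ^ 3"
  have c0: "c \<ge> 0" using L by (simp add: c_def)
  \<comment> \<open>A pointwise bound on the whole space: one integration then compares the gain on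
    the small ball with the loss on the large one, both of known volume.\<close>
  have low: "m * indicat_real (cball y s) x - c * indicat_real (cball x0 (2 * L)) x \<le> - 2 * (indicator \<Omega> x *\<^sub>R dvg F' x)" for x
  proof (cases "x \<in> \<Omega>")
    case False
    then show ?thesis using s(2) c0 by (auto simp: indicator_def)
  next
    case x: True
    define U where "U = u x \<bullet> u x"
    have U: "U \<ge> 0" by (simp add: U_def)
    have Kq: "q x \<le> RK\<^sup>2" if "x \<in> cball y s"
    proof -
      have "norm (x - x0) \<le> RK"
        using that norm_triangle_ineq[of "x - y" "y - x0"] by (simp add: RK_def dist_norm norm_minus_commute)
      then show ?thesis unfolding qn by (intro power_mono) auto
    qed
    have RKL: "RK\<^sup>2 \<le> L\<^sup>2" using L RK by (intro power_mono) auto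
    have S: "sqrt (1 + q x) > 0" using q0[of x] by (simp add: add_pos_nonneg)
    \<comment> \<open>Without \<open>k'\<close> the weight is (1+t)^(-1/2) - t (1+t)^(-3/2) =
      (1+t)^(-3/2), that is \<open>w t\<close>.\<close>
    have eq: "e (q x) + 2 * q x * e' (q x) = k (q x) * w (q x) + 2 * q x * k' (q x) / (L\<^sup>2 * sqrt (1 + q x))"
    proof -
      have "1 + q x > 0" using q0[of x] by simp
      then have "k (q x) / sqrt (1 + q x) - 2 * q x * (k (q x) / (2 * (1 + q x) * sqrt (1 + q x))) = k (q x) * w (q x)"
        using S unfolding w_def by (simp add: divide_simps) (simp add: algebra_simps)
      then show ?thesis by (simp add: e_def e'_def algebra_simps)
    qed
    have wpos: "w (q x) \<ge> 0" using q0[of x] by (simp add: w_def)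
    \<comment> \<open>Since e' \<le> 0, the term with the square of
      \<open>u x \<bullet> (x - x0)\<close> has the favourable sign and is dropped.\<close>
    have "(e (q x) + 2 * q x * e' (q x)) * U \<le> - 2 * DF x"
    proof -
      have "e' (q x) * (u x \<bullet> (x - x0))\<^sup>2 \<le> 0" using e'0 by (simp add: mult_nonpos_nonneg)
      then show ?thesis by (simp add: DF_def U_def algebra_simps)
    qed
    \<comment> \<open>Three zones: for q \<le> L^2 the weight is \<open>w\<close>; between L^2 and 2
      L^2 there is no gain to provide and \<open>c\<close> absorbs the \<open>k'\<close> term;
      beyond, the weight is 0.\<close>
    moreover have "m * indicat_real (cball y s) x - c * indicat_real (cball x0 (2 * L)) x \<le> (e (q x) + 2 * q x * e' (q x)) * U"
    proof (cases "q x \<le> L\<^sup>2")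
      case True
      have "m * indicat_real (cball y s) x \<le> w (q x) * U"
      proof (cases "x \<in> cball y s")
        case True
        have "w (RK\<^sup>2) \<le> w (q x)"
          unfolding w_def using Kq[OF True] q0[of x]
          by (intro divide_left_mono mult_mono mult_pos_pos) (auto intro: add_pos_nonneg)
        then have "m \<le> w (q x) * U"
          unfolding m_def U_def using s(3)[OF True] wpos \<mu> by (intro mult_mono) auto
        then show ?thesis using True by simp
      qed (use wpos U in simp)
      moreover have "0 \<le> c * indicat_real (cball x0 (2 * L)) x" using c0 by simp
      ultimately show ?thesis using True by (simp add: eq k1)
    next
      case False
      then have nK: "x \<notin> cball y s" using Kq RKL by auto
      show ?thesis
      proof (cases "q x < 2 * L\<^sup>2")
        case True
        then have B: "x \<in> cball x0 (2 * L)" using qfar[of x] by auto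
        have XL: "L \<le> norm (x - x0)"
          by (rule power2_le_imp_le) (use False in \<open>auto simp: qn\<close>)
        have "q x * U \<le> \<epsilon>\<^sup>2"
        proof -
          have "(norm (x - x0) * norm (u x))\<^sup>2 \<le> \<epsilon>\<^sup>2"
            using R1[OF x] XL L by (intro power_mono) auto
          then show ?thesis by (simp add: qn U_def power_mult_distrib power2_norm_eq_inner)
        qed
        moreover have "L\<^sup>2 * U \<le> q x * U" using False U by (intro mult_right_mono) auto
        ultimately have UL: "U \<le> \<epsilon>\<^sup>2 / L\<^sup>2" using L by (simp add: field_simps)
        have "L \<le> sqrt (1 + q x)"
          using False by (intro real_le_rsqrt) simp
        then have a: "inverse (sqrt (1 + q x)) \<le> inverse L"
          using L by (intro le_imp_inverse_le) auto
        have b: "2 * q x * (- k' (q x)) \<le> 2 * (2 * L\<^sup>2) * 4"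
          using True k'0 q0 cutoff'_ge[of "q x / L\<^sup>2 - 1"] by (intro mult_mono) (auto simp: k'_def)
        have "0 \<le> 2 * q x * (- k' (q x))" using q0[of x] k'0[of "q x"] by (intro mult_nonneg_nonneg) auto
        then have "2 * q x * (- k' (q x)) * inverse (sqrt (1 + q x)) * U \<le> 2 * (2 * L\<^sup>2) * 4 * inverse L * (\<epsilon>\<^sup>2 / L\<^sup>2)"
          using U S L by (intro mult_mono[OF mult_mono[OF b a] UL]) auto
        then have "2 * q x * (- k' (q x)) * inverse (sqrt (1 + q x)) * U / L\<^sup>2 \<le> 2 * (2 * L\<^sup>2) * 4 * inverse L * (\<epsilon>\<^sup>2 / L\<^sup>2) / L\<^sup>2"
          using L by (intro divide_right_mono) auto
        also have "\<dots> = c" using L by (simp add: c_def field_simps power2_eq_square power3_eq_cube)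
        finally have "- c \<le> 2 * q x * k' (q x) / (L\<^sup>2 * sqrt (1 + q x)) * U"
          by (simp add: divide_inverse mult_ac)
        moreover have "0 \<le> k (q x) * w (q x) * U" using k0 wpos U by simp
        ultimately show ?thesis using nK B unfolding eq by (simp add: distrib_right)
      next
        case False
        then show ?thesis using nK c0 by (simp add: eq k2)
      qed
    qed
    ultimately show ?thesis using x by (simp add: dF)
  qed
  have nonneg: "0 \<le> (LINT x:\<Omega>|lborel. dvg F' x)"
    by (rule signed_divergence_theorem[OF assms(1,2) out])
  have fin: "integrable lborel (indicat_real (cball z t))" for z :: "real^3" and t
    using borel_integrable_compact[of "cball z t" "\<lambda>_. 1::real"] by simp
  have "m * vK - c * measure lborel (cball x0 (2 * L))
     = integral\<^sup>L lborel (\<lambda>x. m * indicat_real (cball y s) x - c * indicat_real (cball x0 (2 * L)) x)"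
    using fin by (simp add: vK_def)
  also have "\<dots> \<le> integral\<^sup>L lborel (\<lambda>x. - 2 * (indicator \<Omega> x *\<^sub>R dvg F' x))"
    by (rule integral_mono[OF _ _ low])
       (use fin set_integrable_dvg[OF assms(1) out] in \<open>auto simp: set_integrable_def\<close>)
  also have "\<dots> = - 2 * (LINT x:\<Omega>|lborel. dvg F' x)"
    unfolding set_lebesgue_integral_def by simp
  also have "\<dots> \<le> 0" using nonneg by simp
  finally have "m * vK \<le> c * measure lborel (cball x0 (2 * L))" by simp
  \<comment> \<open>The large ball has volume 8 L^3 \<omega>, so the powers of \<open>L\<close>
    cancel and 16 * 8 = 128 remains.\<close>
  also have "\<dots> = 128 * \<epsilon>\<^sup>2 * \<omega>"
    using L by (simp add: content_cball c_def \<omega>_def power_mult_distrib)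
  also have "\<dots> = m * vK * (\<omega> / (\<omega> + 1))" using \<omega> by (simp add: \<epsilon>2 field_simps)
  also have "\<dots> < m * vK * 1" using m vK \<omega> by (intro mult_strict_left_mono) auto
  finally show False by simp
qed

section \<open>Boundary sign from star-shapedness, and the stress tensor in coordinates\<close>

lemma defining_function_inward_derivative:
  assumes ch: "local_defining_function \<Omega> p r \<phi> G" and p: "p \<in> frontier \<Omega>"
  shows "closed_segment x0 p \<subseteq> closure \<Omega> \<Longrightarrow> 0 \<le> (p - x0) \<bullet> G p"
    and "closed_segment x0 p \<inter> \<Omega> = {} \<Longrightarrow> (p - x0) \<bullet> G p \<le> 0"
proof -
  from ch have r: "r > 0" and d: "(\<phi> has_derivative (\<lambda>h. G p \<bullet> h)) (at p)"
    and ins: "\<And>x. x \<in> ball p r \<Longrightarrow> x \<in> \<Omega> \<longleftrightarrow> \<phi> x < 0"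
    and fro: "\<And>x. x \<in> ball p r \<Longrightarrow> x \<in> frontier \<Omega> \<longleftrightarrow> \<phi> x = 0"
    unfolding local_defining_function_def by auto
  have \<phi>p: "\<phi> p = 0" using fro[of p] p r by simp
  \<comment> \<open>\<open>g\<close> follows \<open>\<phi>\<close> from \<open>p\<close> towards
    \<open>x0\<close>, starting at 0. A segment in the closure forces g \<le> 0 for small t > 0,
    hence a nonpositive slope at 0; a segment missing \<open>\<Omega>\<close> forces the opposite
    sign.\<close>
  define g where "g t = \<phi> (p + t *\<^sub>R (x0 - p))" for t
  have "((\<lambda>t. p + t *\<^sub>R (x0 - p)) has_derivative (\<lambda>t. t *\<^sub>R (x0 - p))) (at 0)"
    by (auto intro!: derivative_eq_intros)
  from has_derivative_compose[OF this, of \<phi> "\<lambda>h. G p \<bullet> h"] d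
  have dg: "(g has_real_derivative (G p \<bullet> (x0 - p))) (at 0)"
    unfolding g_def has_field_derivative_def by (simp add: mult_commute_abs)
  have g0: "g 0 = 0" by (simp add: g_def \<phi>p)
  obtain t0 where t0: "t0 > 0" "\<And>t. 0 < t \<Longrightarrow> t < t0 \<Longrightarrow> p + t *\<^sub>R (x0 - p) \<in> ball p r \<inter> closed_segment x0 p"
  proof (rule that[of "min 1 (r / (norm (x0 - p) + 1))"])
    show "0 < min 1 (r / (norm (x0 - p) + 1))" using r by (simp add: add_nonneg_pos)
    fix t assume t: "0 < t" "t < min 1 (r / (norm (x0 - p) + 1))"
    then have "t * (norm (x0 - p) + 1) < r" by (simp add: pos_less_divide_eq add_nonneg_pos)
    then have "norm (t *\<^sub>R (x0 - p)) < r" using t by (simp add: distrib_left)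
    then have "p + t *\<^sub>R (x0 - p) \<in> ball p r" by (simp add: dist_norm)
    moreover have "p + t *\<^sub>R (x0 - p) \<in> closed_segment x0 p"
      unfolding closed_segment_def using t by (auto intro!: exI[of _ "1 - t"] simp: algebra_simps)
    ultimately show "p + t *\<^sub>R (x0 - p) \<in> ball p r \<inter> closed_segment x0 p" by simp
  qed
  show "0 \<le> (p - x0) \<bullet> G p" if seg: "closed_segment x0 p \<subseteq> closure \<Omega>"
  proof (rule ccontr)
    assume "\<not> 0 \<le> (p - x0) \<bullet> G p"
    then have "0 < G p \<bullet> (x0 - p)" by (simp add: inner_diff inner_commute)
    from DERIV_pos_inc_right[OF dg this] obtain t1 where t1: "t1 > 0" "\<And>h. 0 < h \<Longrightarrow> h < t1 \<Longrightarrow> g 0 < g (0 + h)" by blast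
    define t where "t = min t0 t1 / 2"
    have t: "0 < t" "t < t0" "t < t1" using t0(1) t1(1) by (auto simp: t_def)
    have "p + t *\<^sub>R (x0 - p) \<in> ball p r" "p + t *\<^sub>R (x0 - p) \<in> closure \<Omega>"
      using t0(2)[OF t(1,2)] seg by auto
    then have "g t \<le> 0"
      using ins[of "p + t *\<^sub>R (x0 - p)"] fro[of "p + t *\<^sub>R (x0 - p)"] closure_Un_frontier[of \<Omega>]
      by (auto simp: g_def)
    then show False using t1(2)[OF t(1,3)] g0 by simp
  qed
  show "(p - x0) \<bullet> G p \<le> 0" if seg: "closed_segment x0 p \<inter> \<Omega> = {}"
  proof (rule ccontr)
    assume "\<not> (p - x0) \<bullet> G p \<le> 0"
    then have "G p \<bullet> (x0 - p) < 0" by (simp add: inner_diff inner_commute)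
    from DERIV_neg_dec_right[OF dg this] obtain t1 where t1: "t1 > 0" "\<And>h. 0 < h \<Longrightarrow> h < t1 \<Longrightarrow> g 0 > g (0 + h)" by blast
    define t where "t = min t0 t1 / 2"
    have t: "0 < t" "t < t0" "t < t1" using t0(1) t1(1) by (auto simp: t_def)
    have "p + t *\<^sub>R (x0 - p) \<in> ball p r" "p + t *\<^sub>R (x0 - p) \<notin> \<Omega>"
      using t0(2)[OF t(1,2)] seg by auto
    then have "g t \<ge> 0"
      using ins[of "p + t *\<^sub>R (x0 - p)"] by (auto simp: g_def)
    then show False using t1(2)[OF t(1,3)] g0 by simp
  qed
qed

lemma sum_Basis_vec:
  fixes f :: "real^'n \<Rightarrow> 'b::comm_monoid_add"
  shows "(\<Sum>b\<in>Basis. f b) = (\<Sum>i\<in>UNIV. f (axis i (1::real)))"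
proof -
  have "(Basis :: (real^'n) set) = (\<lambda>i. axis i 1) ` UNIV" by (auto simp: Basis_vec_def)
  moreover have "inj (\<lambda>i::'n. axis i (1::real))" by (simp add: inj_on_def axis_eq_axis)
  ultimately show ?thesis by (metis (no_types, lifting) sum.reindex_cong)
qed

lemma pderiv3_eq_matrix_entry:
  assumes "(u has_derivative (\<lambda>h. (A::real^3^3) *v h)) (at x)"
  shows "pderiv3 u i j x = A $ i $ j"
proof -
  have "((\<lambda>t. x + t *\<^sub>R axis j 1) has_derivative (\<lambda>t. t *\<^sub>R axis j 1)) (at (0::real))"
    by (auto intro!: derivative_eq_intros)
  from has_derivative_compose[OF this, of u "\<lambda>h. A *v h"] assms
  have "((\<lambda>t. u (x + t *\<^sub>R axis j 1)) has_derivative (\<lambda>t. A *v (t *\<^sub>R axis j 1))) (at (0::real))" by simp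
  then have "((\<lambda>t. u (x + t *\<^sub>R axis j 1) $ i) has_derivative (\<lambda>t. (A *v (t *\<^sub>R axis j 1)) $ i)) (at (0::real))"
    by (rule bounded_linear.has_derivative[OF bounded_linear_vec_nth])
  moreover have "(\<lambda>t. (A *v (t *\<^sub>R axis j 1)) $ i) = (\<lambda>t. A $ i $ j * t)"
    by (simp add: fun_eq_iff matrix_vector_mult_scaleR matrix_vector_mul_component inner_axis mult.commute)
  ultimately have "((\<lambda>t. u (x + t *\<^sub>R axis j 1) $ i) has_real_derivative A $ i $ j) (at 0)"
    by (simp add: has_field_derivative_def)
  then show ?thesis unfolding pderiv3_def by (rule DERIV_imp_deriv)
qed

text \<open>For the symmetric tensor T, div (T X) = X \<bullet> div T + tr T. Here div T is the sum
  of (div u) u and the cross product of curl u with u, and tr T = |u|^2 - (3/2) |u|^2 in dimension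
  three.\<close>

lemma stress_field_dvg:
  assumes J: "continuous_on \<Omega> J" "\<And>x. x \<in> \<Omega> \<Longrightarrow> (u has_derivative (\<lambda>h. (J x :: real^3^3) *v h)) (at x)"
    and curl: "\<And>x. x \<in> \<Omega> \<Longrightarrow> cross3 (curl3 u x) (u x) = 0"
    and div: "\<And>x. x \<in> \<Omega> \<Longrightarrow> div3 u x = 0"
  obtains V' where "C1_deriv_on \<Omega> (stress_field x0 u) V'"
    "\<And>x. x \<in> \<Omega> \<Longrightarrow> dvg V' x = - (1/2) * (u x \<bullet> u x)"
proof -
  have C1u: "C1_deriv_on \<Omega> u (\<lambda>x h. J x *v h)"
    unfolding C1_deriv_on_def
  proof (intro conjI ballI allI)
    show "continuous_on \<Omega> (\<lambda>x. J x *v h)" for h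
      unfolding matrix_vector_mult_def by (intro continuous_intros J(1))
  qed (rule J(2))
  have C1X: "C1_deriv_on \<Omega> (\<lambda>x. x - x0) (\<lambda>x h. h)"
    unfolding C1_deriv_on_def by (auto intro!: derivative_eq_intros)
  note C1 = C1_deriv_on_add[OF
      C1_deriv_on_scaleR[OF C1_deriv_on_inner[OF C1u C1X] C1u]
      C1_deriv_on_scaleR[OF C1_deriv_on_scaleR[OF C1_deriv_on_const[of \<Omega> "- (1/2)::real"] C1_deriv_on_inner[OF C1u C1u]] C1X]]
  define V' where "V' x h = (u x \<bullet> (x - x0)) *\<^sub>R (J x *v h) + (u x \<bullet> h + (J x *v h) \<bullet> (x - x0)) *\<^sub>R u x
     + ((- (1/2) * (u x \<bullet> u x)) *\<^sub>R h + (- (1/2) * (u x \<bullet> (J x *v h) + (J x *v h) \<bullet> u x)) *\<^sub>R (x - x0))" for x h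
  have "C1_deriv_on \<Omega> (stress_field x0 u) V'"
    using C1 unfolding stress_field_def[abs_def] V'_def[abs_def] by simp
  moreover have "dvg V' x = - (1/2) * (u x \<bullet> u x)" if x: "x \<in> \<Omega>" for x
  proof -
    note pd = pderiv3_eq_matrix_entry[OF J(2)[OF x]]
    have tr: "J x $ 1 $ 1 + J x $ 2 $ 2 + J x $ 3 $ 3 = 0"
      using div[OF x] by (simp add: div3_def pd)
    define X where "X = x - x0"
    have "curl3 u x = vector [J x $ 3 $ 2 - J x $ 2 $ 3, J x $ 1 $ 3 - J x $ 3 $ 1, J x $ 2 $ 1 - J x $ 1 $ 2]"
      by (simp add: curl3_def pd)
    then have "X \<bullet> cross3 (vector [J x $ 3 $ 2 - J x $ 2 $ 3, J x $ 1 $ 3 - J x $ 3 $ 1, J x $ 2 $ 1 - J x $ 1 $ 2]) (u x) = 0"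
      using curl[OF x] by simp
    \<comment> \<open>A polynomial identity in the entries of \<open>J x\<close> and the components
      of \<open>u x\<close> and \<open>X\<close>, valid for every matrix; the two equations are
      applied only afterwards.\<close>
    moreover have "dvg V' x = - (1/2) * (u x \<bullet> u x) + (u x \<bullet> X) * (J x $ 1 $ 1 + J x $ 2 $ 2 + J x $ 3 $ 3)
      + X \<bullet> cross3 (vector [J x $ 3 $ 2 - J x $ 2 $ 3, J x $ 1 $ 3 - J x $ 3 $ 1, J x $ 2 $ 1 - J x $ 1 $ 2]) (u x)"
      unfolding dvg_def V'_def X_def[symmetric] sum_Basis_vec
      by (simp add: sum_3 inner_vec_def matrix_vector_mult_def axis_def cross3_def) (simp add: field_simps)
    ultimately show ?thesis using tr by simp
  qed
  ultimately show thesis by (rule that)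
qed

section \<open>Reduction of the two boundary conditions to a sign of the flux\<close>

theorem theorem2:
  fixes \<Omega> :: "(real^3) set" and u :: "real^3 \<Rightarrow> real^3"
  assumes "domain3 \<Omega>" and "\<not> bounded \<Omega>" and "C1_boundary \<Omega>"
    and "UNIV - closure \<Omega> \<noteq> {}"
    and "C1_on \<Omega> u" and "continuous_on (closure \<Omega>) u"
    and "\<forall>x\<in>\<Omega>. cross3 (curl3 u x) (u x) = 0"
    and "\<forall>x\<in>\<Omega>. div3 u x = 0"
    and "\<forall>e>0. \<exists>R. \<forall>x\<in>\<Omega>. norm x \<ge> R \<longrightarrow> norm x * norm (u x) \<le> e"
    and "(star_shaped_domain \<Omega> \<and>
           (\<forall>p\<in>frontier \<Omega>. \<forall>n. outer_normal \<Omega> p n \<longrightarrow> cross3 (u p) n = 0))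
         \<or> (\<exists>D. star_shaped_domain D \<and> \<Omega> = UNIV - closure D \<and>
           (\<forall>p\<in>frontier \<Omega>. \<forall>n. outer_normal \<Omega> p n \<longrightarrow> u p \<bullet> n = 0))"
  shows "\<forall>x\<in>\<Omega>. u x = 0"
proof -
  have op: "open \<Omega>" using assms(1) by (simp add: domain3_def)
  have Gp: "G p \<noteq> 0" "outer_normal \<Omega> p ((1 / norm (G p)) *\<^sub>R G p)"
    if "local_defining_function \<Omega> p r \<phi> G" for p r \<phi> G
    using that unfolding outer_normal_def by (auto simp: local_defining_function_def)
  have stress: "stress_field x0 u p \<bullet> g = (u p \<bullet> (p - x0)) * (u p \<bullet> g) - 1/2 * (u p \<bullet> u p) * ((p - x0) \<bullet> g)" for x0 p g
    by (simp add: stress_field_def inner_diff_left)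
  obtain x0 where bd: "\<And>p r \<phi> G. p \<in> frontier \<Omega> \<Longrightarrow> local_defining_function \<Omega> p r \<phi> G \<Longrightarrow>
      0 \<le> stress_field x0 u p \<bullet> G p"
    using assms(10)
  proof (elim disjE conjE exE)
    assume star: "star_shaped_domain \<Omega>"
      and tang: "\<forall>p\<in>frontier \<Omega>. \<forall>n. outer_normal \<Omega> p n \<longrightarrow> cross3 (u p) n = 0"
    from star obtain x0 where x0: "\<And>x. x \<in> closure \<Omega> \<Longrightarrow> closed_segment x0 x \<subseteq> closure \<Omega>"
      unfolding star_shaped_domain_def by blast
    show thesis
    proof (rule that)
      fix p r \<phi> G assume p: "p \<in> frontier \<Omega>" and ch: "local_defining_function \<Omega> p r \<phi> G"
      have "p \<in> closure \<Omega>" using p by (simp add: frontier_def)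
      from defining_function_inward_derivative(1)[OF ch p x0[OF this]]
      have X: "0 \<le> (p - x0) \<bullet> G p" .
      \<comment> \<open>As \<open>G p\<close> is nonzero, \<open>u p\<close> is a multiple of it,
        and the two flux terms combine to |u|^2/2 times
        \<open>(p - x0) \<bullet> G p\<close>.\<close>
      have "cross3 (G p) (u p) = 0"
        using tang p Gp[OF ch] by (metis cross_mult_right cross_skew divide_eq_0_iff neg_equal_0_iff_equal norm_eq_zero scale_eq_0_iff zero_neq_one)
      then obtain l where l: "u p = l *\<^sub>R G p"
        using Gp(1)[OF ch] unfolding cross_eq_0 collinear_lemma by (metis scaleR_zero_left)
      have "stress_field x0 u p \<bullet> G p = 1/2 * (l\<^sup>2 * (G p \<bullet> G p) * ((p - x0) \<bullet> G p))"
        unfolding stress l by (simp add: power2_eq_square inner_commute field_simps)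
      also have "0 \<le> \<dots>"
        using X by (intro mult_nonneg_nonneg) auto
      finally show "0 \<le> stress_field x0 u p \<bullet> G p" .
    qed
  next
    fix D assume star: "star_shaped_domain D" and D: "\<Omega> = UNIV - closure D"
      and norm: "\<forall>p\<in>frontier \<Omega>. \<forall>n. outer_normal \<Omega> p n \<longrightarrow> u p \<bullet> n = 0"
    from star obtain x0 where x0: "\<And>x. x \<in> closure D \<Longrightarrow> closed_segment x0 x \<subseteq> closure D"
      unfolding star_shaped_domain_def by blast
    show thesis
    proof (rule that)
      fix p r \<phi> G assume p: "p \<in> frontier \<Omega>" and ch: "local_defining_function \<Omega> p r \<phi> G"
      have "p \<in> closure D" using p op D by (simp add: frontier_def interior_open)
      then have "closed_segment x0 p \<inter> \<Omega> = {}" using x0 D by blast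
      from defining_function_inward_derivative(2)[OF ch p this]
      have X: "(p - x0) \<bullet> G p \<le> 0" .
      have "u p \<bullet> ((1 / norm (G p)) *\<^sub>R G p) = 0" using norm p Gp(2)[OF ch] by blast
      then have "u p \<bullet> G p = 0" using Gp(1)[OF ch] by simp
      \<comment> \<open>Tangency removes the first flux term. The remaining minus sign is
        compensated by the reversed sign of \<open>(p - x0) \<bullet> G p\<close>, the star-shaped
        set now lying outside \<open>\<Omega>\<close>.\<close>
      then have "stress_field x0 u p \<bullet> G p = 1/2 * ((u p \<bullet> u p) * (- ((p - x0) \<bullet> G p)))"
        unfolding stress by simp
      also have "0 \<le> \<dots>"
        using X by (intro mult_nonneg_nonneg) auto
      finally show "0 \<le> stress_field x0 u p \<bullet> G p" .
    qed
  qed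
  obtain J where J: "continuous_on \<Omega> J" "\<And>x. x \<in> \<Omega> \<Longrightarrow> (u has_derivative (\<lambda>h. (J x :: real^3^3) *v h)) (at x)"
    using assms(5) unfolding C1_on_def by blast
  obtain V' where V': "C1_deriv_on \<Omega> (stress_field x0 u) V'"
    "\<And>x. x \<in> \<Omega> \<Longrightarrow> dvg V' x = - (1/2) * (u x \<bullet> u x)"
    by (rule stress_field_dvg[OF J]) (use assms(7,8) in auto)
  have decay: "\<exists>R. \<forall>x\<in>\<Omega>. norm (x - x0) \<ge> R \<longrightarrow> norm (x - x0) * norm (u x) \<le> \<epsilon>" if \<epsilon>: "\<epsilon> > 0" for \<epsilon>
  proof -
    \<comment> \<open>Once |x - x0| \<ge> 2 |x0|, also |x - x0| \<le> 2 |x|. Moving the centre from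
      0 to \<open>x0\<close> thus costs a factor 2, whence \<open>\<epsilon> / 2\<close>.\<close>
    obtain R where R: "\<And>x. x \<in> \<Omega> \<Longrightarrow> R \<le> norm x \<Longrightarrow> norm x * norm (u x) \<le> \<epsilon> / 2"
      using assms(9)[rule_format, of "\<epsilon> / 2"] \<epsilon> by auto
    show ?thesis
    proof (intro exI ballI impI)
      fix x assume x: "x \<in> \<Omega>" "max (R + norm x0) (2 * norm x0) \<le> norm (x - x0)"
      have n: "norm (x - x0) \<le> norm x + norm x0" by (rule norm_triangle_ineq4)
      have "norm (x - x0) * norm (u x) \<le> (2 * norm x) * norm (u x)"
        using n x(2) by (intro mult_right_mono) auto
      also have "\<dots> \<le> \<epsilon>" using R[OF x(1)] n x(2) by simp
      finally show "norm (x - x0) * norm (u x) \<le> \<epsilon>" .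
    qed
  qed
  show ?thesis
    by (rule vanishing_of_stress_identity[OF op assms(3,6) V']) (use bd decay in blast)+
qed

end
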